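(* There is an absolute constant $c>0$ such that the following holds for every positive integer $k$. Let $\mathcal{A}$ and $\mathcal{B}$ be two families of $n$ 0-1 curves each. If $\mathcal{A}$ is $k$-intersecting and $\mathcal{B}$ is 1-intersecting, then there are subfamilies $\mathcal{A}_0\subseteq\mathcal{A}$ and $\mathcal{B}_0\subseteq\mathcal{B}$ with $|\mathcal{A}_0|=|\mathcal{B}_0|\ge cn/k$ such that either every $\alpha\in\mathcal{A}_0$ intersects every $\beta\in\mathcal{B}_0$, or every $\alpha\in\mathcal{A}_0$ is disjoint from every $\beta\in\mathcal{B}_0$.
   Context: A 0-1 curve is the graph $\{(x,f(x)):x\in[0,1]\}\subset\mathbb{R}^2$ of a continuous function $f:[0,1]\to\mathbb{R}$. Throughout, curves in the collections are assumed to meet only at proper crossings: if two curves $\alpha,\beta$ share a point, then $\alpha$ passes to the other side of $\beta$ at this point. A collection of curves is $k$-intersecting if any two curves in it intersect in at most $k$ points. (No restriction is placed on intersections between a curve of $\mathcal{A}$ and a curve of $\mathcal{B}$.) The paper states the bound as $\Omega(n/k)$. *)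

theory Defs
  imports "HOL-Analysis.Analysis"
begin

definition graph01 :: "(real \<Rightarrow> real) \<Rightarrow> (real \<times> real) set" where
  "graph01 f = (\<lambda>x. (x, f x)) ` {0..1}"

definition zero_one_curve :: "(real \<times> real) set \<Rightarrow> bool" where
  "zero_one_curve \<gamma> \<longleftrightarrow> (\<exists>f. continuous_on {0..1} f \<and> \<gamma> = graph01 f)"

definition below_on :: "real set \<Rightarrow> (real \<times> real) set \<Rightarrow> (real \<times> real) set \<Rightarrow> bool" where
  "below_on I \<alpha> \<beta> \<longleftrightarrow> (\<forall>x\<in>I. \<forall>y z. (x, y) \<in> \<alpha> \<longrightarrow> (x, z) \<in> \<beta> \<longrightarrow> y < z)"

text \<open>Passing to the other side requires curve on both sides of the point, so there is no
  proper crossing on the vertical lines over \<open>0\<close> and \<open>1\<close>.\<close>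

definition properly_crosses_at ::
    "(real \<times> real) set \<Rightarrow> (real \<times> real) set \<Rightarrow> real \<times> real \<Rightarrow> bool" where
  "properly_crosses_at \<alpha> \<beta> p \<longleftrightarrow>
     p \<in> \<alpha> \<inter> \<beta> \<and>
     (\<exists>\<epsilon>>0. 0 \<le> fst p - \<epsilon> \<and> fst p + \<epsilon> \<le> 1 \<and>
        (below_on {fst p - \<epsilon><..<fst p} \<alpha> \<beta> \<and> below_on {fst p<..<fst p + \<epsilon>} \<beta> \<alpha> \<or>
         below_on {fst p - \<epsilon><..<fst p} \<beta> \<alpha> \<and> below_on {fst p<..<fst p + \<epsilon>} \<alpha> \<beta>))"

definition only_proper_crossings :: "(real \<times> real) set set \<Rightarrow> bool" where
  "only_proper_crossings \<C> \<longleftrightarrow>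
     pairwise (\<lambda>\<alpha> \<beta>. \<forall>p\<in>\<alpha> \<inter> \<beta>. properly_crosses_at \<alpha> \<beta> p) \<C>"

definition k_intersecting :: "nat \<Rightarrow> (real \<times> real) set set \<Rightarrow> bool" where
  "k_intersecting k \<C> \<longleftrightarrow>
     pairwise (\<lambda>\<alpha> \<beta>. finite (\<alpha> \<inter> \<beta>) \<and> card (\<alpha> \<inter> \<beta>) \<le> k) \<C>"

text \<open>Proper crossing is a condition within one collection; two curves from different collections
  may meet arbitrarily.\<close>

definition curve_collection :: "(real \<times> real) set set \<Rightarrow> bool" where
  "curve_collection \<C> \<longleftrightarrow>
     finite \<C> \<and> (\<forall>\<gamma>\<in>\<C>. zero_one_curve \<gamma>) \<and> only_proper_crossings \<C>"

end

theory Submission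
  imports Defs
begin

text \<open>Passing to halves (and possibly reflecting in the horizontal axis) we may assume that every
  curve of \<open>\<A>\<close> starts below every curve of \<open>\<B>\<close>. Cut \<open>[0,1]\<close> into \<open>m = O(k)\<close> strips with few crossings
  of \<open>\<A>\<close> in each. Inside a strip \<open>\<A>\<close> is then nearly ordered: apart from a small exceptional set, all
  its curves lie below each of linearly many top curves. For the pseudolines \<open>\<B>\<close> the points where
  \<open>\<beta>\<close> has rank below \<open>r\<close> span an interval on which its rank stays below \<open>2r\<close>. With \<open>r\<close> of order \<open>n/k\<close>
  and cuts at the ends of these intervals, in each strip all of \<open>\<B>\<close>, apart from the \<open>O(r)\<close> curves
  whose interval meets the strip, lie above each of about \<open>r\<close> bottom curves.

  If \<open>n/4\<close> curves of \<open>\<B>\<close> somewhere reach below all top curves of \<open>\<A>\<close> of the strip, then \<open>n/(4m)\<close> of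
  them do so in the same strip and meet all those top curves; likewise with the roles exchanged.
  Otherwise discard these curves. Now a pair can only meet in a strip where both members are
  exceptional. A typical \<open>\<beta>\<close> is exceptional only in boundedly many consecutive strips, so about
  \<open>n/m\<close> curves \<open>\<beta>\<close> are exceptional only within a common bounded set of strips, and most of \<open>\<A>\<close> is
  exceptional in none of those.\<close>

section \<open>Ranks and cut points in finite sets\<close>

lemma lower_part_exists:
  fixes F :: "'a \<Rightarrow> 'b::linorder"
  assumes "finite X" "j \<le> card X"
  shows "\<exists>Y\<subseteq>X. card Y = j \<and> (\<forall>y\<in>Y. \<forall>z\<in>X - Y. F y \<le> F z)"
  using assms(2)
proof (induction j)
  case 0
  then show ?case by (intro exI[of _ "{}"]) auto
next
  case (Suc j)
  then obtain Y where Y: "Y \<subseteq> X" "card Y = j" "\<And>y z. y \<in> Y \<Longrightarrow> z \<in> X - Y \<Longrightarrow> F y \<le> F z"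
    by auto
  have fY: "finite Y" using Y assms finite_subset by auto
  have "X - Y \<noteq> {}" using Suc.prems Y(1,2) by auto
  then obtain z where z: "z \<in> X - Y" "\<And>u. u \<in> X - Y \<Longrightarrow> F z \<le> F u"
    using ex_min_if_finite[of "F ` (X - Y)"] assms(1)
    by (metis (no_types, opaque_lifting) finite_Diff arg_min_if_finite(1) arg_min_least)
  show ?case
    using Y z fY by (intro exI[of _ "insert z Y"]) auto
qed

text \<open>The highest element of rank below \<open>j\<close> has all the others of this kind at or
  below it, so there are fewer than \<open>j\<close> others. Ties do no harm, since they count
  towards the rank.\<close>

lemma card_low_rank_le:
  fixes F :: "'a \<Rightarrow> real"
  assumes "finite S"
  shows "card {s\<in>S. card {t\<in>S - {s}. F t \<le> F s} < j} \<le> j"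
proof (cases "{s\<in>S. card {t\<in>S - {s}. F t \<le> F s} < j} = {}")
  case False
  define T where "T = {s\<in>S. card {t\<in>S - {s}. F t \<le> F s} < j}"
  have fT: "finite T" using assms by (simp add: T_def)
  then obtain s where s: "s \<in> T" "\<And>t. t \<in> T \<Longrightarrow> F t \<le> F s"
    using False Max_in[of "F ` T"] Max_ge[of "F ` T"] unfolding T_def[symmetric]
    by (metis (no_types, lifting) empty_is_image finite_imageI imageE imageI)
  have "T - {s} \<subseteq> {t\<in>S - {s}. F t \<le> F s}" using s by (auto simp: T_def)
  then have "card (T - {s}) \<le> card {t\<in>S - {s}. F t \<le> F s}"
    using assms by (intro card_mono) auto
  also have "\<dots> < j" using s(1) by (simp add: T_def)
  finally have "card T \<le> j" using s(1) fT by (simp add: card_Diff_singleton)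
  then show ?thesis by (simp add: T_def)
qed (metis card.empty le0)

text \<open>Injectivity matters: if all values coincide, every element has rank
  \<open>card S - 1\<close>. This is why ranks are later evaluated at points where no two curves of
  the family meet.\<close>

lemma card_low_rank_ge:
  fixes F :: "'a \<Rightarrow> real"
  assumes "finite S" "inj_on F S" "j \<le> card S"
  shows "j \<le> card {s\<in>S. card {t\<in>S - {s}. F t \<le> F s} < j}"
proof -
  obtain Y where Y: "Y \<subseteq> S" "card Y = j" "\<And>y z. y \<in> Y \<Longrightarrow> z \<in> S - Y \<Longrightarrow> F y \<le> F z"
    using lower_part_exists[OF assms(1,3), of F] by blast
  have fY: "finite Y" using Y assms finite_subset by auto
  have "card {t\<in>S - {y}. F t \<le> F y} < j" if "y \<in> Y" for y
  proof -
    have "{t\<in>S - {y}. F t \<le> F y} \<subseteq> Y - {y}"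
    proof
      fix t assume t: "t \<in> {t\<in>S - {y}. F t \<le> F y}"
      have "t \<in> Y"
      proof (rule ccontr)
        assume "t \<notin> Y"
        then have "F t = F y" using Y(3)[OF that, of t] t by auto
        then show False using inj_onD[OF assms(2)] t that Y(1) by auto
      qed
      then show "t \<in> Y - {y}" using t by auto
    qed
    then have "card {t\<in>S - {y}. F t \<le> F y} \<le> card (Y - {y})"
      using fY by (intro card_mono) auto
    also have "\<dots> < card Y" using that fY by (rule card_Diff1_less[rotated])
    finally show ?thesis using Y by simp
  qed
  then have "Y \<subseteq> {s\<in>S. card {t\<in>S - {s}. F t \<le> F s} < j}" using Y by auto
  then have "card Y \<le> card {s\<in>S. card {t\<in>S - {s}. F t \<le> F s} < j}"
    using assms(1) by (intro card_mono) auto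
  then show ?thesis using Y by simp
qed

text \<open>Greedy from the left: the \<open>q\<close>-th smallest value becomes a cut and all
  indices at or below it are dropped, so each cut pays for \<open>q\<close> indices. Counting only
  in open intervals allows arbitrarily many values to coincide at a cut.\<close>

lemma cut_points_exist:
  fixes z :: "'i \<Rightarrow> real"
  assumes "finite Z" "q > 0"
  shows "\<exists>P. finite P \<and> P \<subseteq> z ` Z \<and> card P * q \<le> card Z \<and>
    (\<forall>l u. P \<inter> {l<..<u} = {} \<longrightarrow> card {i\<in>Z. z i \<in> {l<..<u}} \<le> q)"
  using assms(1)
proof (induction "card Z" arbitrary: Z rule: less_induct)
  case less
  show ?case
  proof (cases "card Z \<le> q")
    case True
    have "card {i\<in>Z. z i \<in> {l<..<u}} \<le> q" for l u
      using card_mono[of Z "{i\<in>Z. z i \<in> {l<..<u}}"] less.prems True by auto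
    then show ?thesis by (intro exI[of _ "{}"]) auto
  next
    case False
    obtain Y where Y: "Y \<subseteq> Z" "card Y = q" "\<And>y v. y \<in> Y \<Longrightarrow> v \<in> Z - Y \<Longrightarrow> z y \<le> z v"
      using lower_part_exists[OF less.prems, of q z] False by auto
    have fY: "finite Y" using Y less.prems finite_subset by auto
    have "Y \<noteq> {}" using Y(2) assms(2) by auto
    then obtain y where y: "y \<in> Y" "\<And>v. v \<in> Y \<Longrightarrow> z v \<le> z y"
      using Max_in[of "z ` Y"] Max_ge[of "z ` Y"] fY
    by (metis (no_types, lifting) empty_is_image finite_imageI imageE imageI)
    define Z' where "Z' = {i\<in>Z. z y < z i}"
    have sub: "Z' \<subseteq> Z - Y" using y by (force simp: Z'_def)
    then have "card Z' \<le> card (Z - Y)" using less.prems by (intro card_mono) auto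
    then have c: "card Z' + q \<le> card Z"
      using Y(1,2) fY False by (simp add: card_Diff_subset)
    have fZ': "finite Z'" using less.prems by (simp add: Z'_def)
    obtain P where P: "finite P" "P \<subseteq> z ` Z'" "card P * q \<le> card Z'"
      "\<And>l u. P \<inter> {l<..<u} = {} \<Longrightarrow> card {i\<in>Z'. z i \<in> {l<..<u}} \<le> q"
      using less.hyps[OF _ fZ'] c assms(2) by auto
    have "card {i\<in>Z. z i \<in> {l<..<u}} \<le> q" if lu: "insert (z y) P \<inter> {l<..<u} = {}" for l u
    proof (cases "u \<le> z y")
      case True
      have "{i\<in>Z. z i \<in> {l<..<u}} \<subseteq> Y" using Y(3)[OF y(1)] True by force
      then show ?thesis using card_mono[OF fY] Y(2) by metis
    next
      case False
      then have "z y \<le> l" using lu by auto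
      then have "{i\<in>Z. z i \<in> {l<..<u}} = {i\<in>Z'. z i \<in> {l<..<u}}" by (auto simp: Z'_def)
      then show ?thesis using P(4)[of l u] lu by auto
    qed
    moreover have "card (insert (z y) P) * q \<le> card Z"
    proof -
      have "card (insert (z y) P) * q \<le> (card P + 1) * q"
        by (intro mult_right_mono) (auto simp: card_insert_if P(1))
      then show ?thesis using P(3) c by (simp add: algebra_simps)
    qed
    moreover have "insert (z y) P \<subseteq> z ` Z" using P(2) sub y(1) Y(1) by auto
    ultimately show ?thesis using P(1) by (intro exI[of _ "insert (z y) P"]) auto
  qed
qed

section \<open>Crossings of continuous functions, and separating curves in a strip with few
  crossings\<close>

lemma le_on_closed_interval:
  fixes f g :: "real \<Rightarrow> real"
  assumes "l < u" "continuous_on {l..u} f" "continuous_on {l..u} g"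
    and "\<And>x. x \<in> {l<..<u} \<Longrightarrow> f x \<le> g x" and "x \<in> {l..u}"
  shows "f x \<le> g x"
proof -
  have "x \<in> closure {l<..<u}" using assms by simp
  moreover have "continuous_on (closure {l<..<u}) (\<lambda>x. g x - f x)"
    using assms by (auto intro!: continuous_intros)
  ultimately have "0 \<le> g x - f x"
    using assms(4) continuous_ge_on_closure[of "{l<..<u}" "\<lambda>x. g x - f x" x 0] by simp
  then show ?thesis by simp
qed

lemma crossing_between:
  fixes f g :: "real \<Rightarrow> real"
  assumes "continuous_on S f" "continuous_on S g" "is_interval S" "x \<in> S" "y \<in> S"
    and "f x \<le> g x" "g y \<le> f y"
  shows "\<exists>z\<in>S. min x y \<le> z \<and> z \<le> max x y \<and> f z = g z"
proof -
  have sub: "closed_segment x y \<subseteq> S"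
    using assms(3-5) by (simp add: closed_segment_subset is_interval_convex)
  have "continuous_on (closed_segment x y) (\<lambda>t. f t - g t)"
    using assms(1,2) sub by (auto intro!: continuous_intros intro: continuous_on_subset)
  then have "connected ((\<lambda>t. f t - g t) ` closed_segment x y)"
    by (rule connected_continuous_image) simp
  moreover have "f x - g x \<in> (\<lambda>t. f t - g t) ` closed_segment x y"
    "f y - g y \<in> (\<lambda>t. f t - g t) ` closed_segment x y" by auto
  ultimately have "0 \<in> (\<lambda>t. f t - g t) ` closed_segment x y"
    using assms(6,7) by (meson connected_contains_Icc diff_ge_0_iff_ge diff_le_0_iff_le
        atLeastAtMost_iff subsetD)
  then obtain z where "z \<in> closed_segment x y" "f z = g z" by auto
  then show ?thesis using sub
    by (intro bexI[of _ z]) (auto simp: closed_segment_eq_real_ivl split: if_splits)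
qed

text \<open>By double counting, at most \<open>d\<close> curves cross \<open>d\<close> or more
  others inside the strip. Among the remaining curves, one of rank below \<open>2 * d\<close> and
  one of rank at least \<open>4 * d\<close> at a common point cannot change order: too many curves
  lie between them there.\<close>

lemma low_separator_if_few_crossings:
  fixes f :: "'a \<Rightarrow> real \<Rightarrow> real"
  assumes fin: "finite A" and lu: "l < u"
    and cont: "\<And>a. a \<in> A \<Longrightarrow> continuous_on {l..u} (f a)"
    and Z: "Z = {(a, b, x). a \<in> A \<and> b \<in> A \<and> a \<noteq> b \<and> x \<in> {l<..<u} \<and> f a x = f b x}"
    and finZ: "finite Z" and cardZ: "card Z \<le> d * d" and d: "d > 0" "4 * d \<le> card A"
  shows "\<exists>K E. K \<subseteq> A \<and> E \<subseteq> A \<and> d \<le> card K \<and> card E \<le> 5 * d \<and>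
    (\<forall>a\<in>A - E. \<forall>b\<in>K. \<forall>x\<in>{l..u}. f b x \<le> f a x)"
proof -
  \<comment> \<open>At a point without crossings all values are distinct, as
    \<open>card_low_rank_ge\<close> demands.\<close>
  have "infinite ({l<..<u} - (\<lambda>(a, b, x). x) ` Z)"
    using finZ lu by (intro Diff_infinite_finite) auto
  then obtain p where p: "p \<in> {l<..<u}" "p \<notin> (\<lambda>(a, b, x). x) ` Z"
    by (metis DiffE finite.emptyI ex_in_conv)
  have inj: "inj_on (\<lambda>a. f a p) A"
  proof (rule inj_onI, rule ccontr)
    fix a b assume "a \<in> A" "b \<in> A" "f a p = f b p" "a \<noteq> b"
    then have "(a, b, p) \<in> Z" using p(1) Z by auto
    then show False using p(2) by force
  qed
  define N where "N a = {b\<in>A - {a}. \<exists>x\<in>{l<..<u}. f a x = f b x}" for a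
  have finN: "finite (N a)" for a using fin by (simp add: N_def)
  define Bad where "Bad = {a\<in>A. d \<le> card (N a)}"
  have finBad: "finite Bad" using fin by (simp add: Bad_def)
  have cBad: "card Bad \<le> d"
  proof -
    have "card Bad * d \<le> (\<Sum>a\<in>Bad. card (N a))"
      using sum_bounded_below[of Bad d "\<lambda>a. card (N a)"] by (auto simp: Bad_def)
    also have "\<dots> = card (Sigma Bad N)" using finBad finN by simp
    also have "\<dots> \<le> card ((\<lambda>(a, b, x). (a, b)) ` Z)"
    proof (rule card_mono)
      show "Sigma Bad N \<subseteq> (\<lambda>(a, b, x). (a, b)) ` Z"
      proof
        fix ab assume "ab \<in> Sigma Bad N"
        then obtain a b x where "ab = (a, b)" "(a, b, x) \<in> Z"
          by (auto simp: Bad_def N_def Z)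
        then show "ab \<in> (\<lambda>(a, b, x). (a, b)) ` Z" by force
      qed
    qed (use finZ in simp)
    also have "\<dots> \<le> d * d" using card_image_le[OF finZ] cardZ le_trans by blast
    finally show ?thesis using d(1) by simp
  qed
  define rk where "rk a = card {b\<in>A - {a}. f b p \<le> f a p}" for a
  define K where "K = {a\<in>A. rk a < 2 * d} - Bad"
  define E where "E = {a\<in>A. rk a < 4 * d} \<union> Bad"
  have "2 * d \<le> card {a\<in>A. rk a < 2 * d}"
    unfolding rk_def by (rule card_low_rank_ge[OF fin inj]) (use d in auto)
  also have "\<dots> \<le> card K + card Bad"
    unfolding K_def using finBad diff_card_le_card_Diff[OF finBad, of "{a\<in>A. rk a < 2 * d}"]
    by linarith
  finally have cK: "d \<le> card K" using cBad by simp
  have "card E \<le> card {a\<in>A. rk a < 4 * d} + card Bad" unfolding E_def by (rule card_Un_le)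
  also have "card {a\<in>A. rk a < 4 * d} \<le> 4 * d"
    unfolding rk_def by (rule card_low_rank_le[OF fin])
  finally have cE: "card E \<le> 5 * d" using cBad by simp
  \<comment> \<open>If \<open>a\<close> and \<open>b\<close> swap, every curve between them at \<open>p\<close> crosses one of them: too many for curves
    outside \<open>Bad\<close>.\<close>
  have open_le: "f b x \<le> f a x" if a: "a \<in> A - E" and b: "b \<in> K" and x: "x \<in> {l<..<u}" for a b x
  proof (rule ccontr)
    assume "\<not> f b x \<le> f a x"
    then have gt: "f a x < f b x" by simp
    have aA: "a \<in> A" "rk a \<ge> 4 * d" "card (N a) < d" using a by (auto simp: E_def Bad_def)
    have bA: "b \<in> A" "rk b < 2 * d" "card (N b) < d" using b by (auto simp: K_def Bad_def)
    define M where "M = {c\<in>A. f b p < f c p \<and> f c p < f a p}"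
    have "{c\<in>A - {a}. f c p \<le> f a p} \<subseteq> M \<union> insert b {c\<in>A - {b}. f c p \<le> f b p}"
    proof
      fix c assume c: "c \<in> {c\<in>A - {a}. f c p \<le> f a p}"
      then have "f c p \<noteq> f a p" using inj_onD[OF inj, of c a] aA(1) by auto
      then show "c \<in> M \<union> insert b {c\<in>A - {b}. f c p \<le> f b p}" using c by (auto simp: M_def)
    qed
    then have "rk a \<le> card (M \<union> insert b {c\<in>A - {b}. f c p \<le> f b p})"
      unfolding rk_def using fin by (intro card_mono) (auto simp: M_def)
    also have "\<dots> \<le> card M + card (insert b {c\<in>A - {b}. f c p \<le> f b p})" by (rule card_Un_le)
    \<comment> \<open>The extra 1 stands for \<open>b\<close> itself. Since
      \<open>rk b < 2 * d\<close> is strict, \<open>M\<close> still has \<open>2 * d\<close>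
      members, while \<open>N a\<close> and \<open>N b\<close> together have at most
      \<open>2 * d - 2\<close>.\<close>
    also have "card (insert b {c\<in>A - {b}. f c p \<le> f b p}) = Suc (rk b)"
      using fin unfolding rk_def by (subst card_insert_disjoint) auto
    finally have "2 * d \<le> card M" using aA bA by linarith
    moreover have "M \<subseteq> N a \<union> N b"
    proof
      fix c assume c: "c \<in> M"
      have contc: "continuous_on {l<..<u} (f e)" if "e \<in> A" for e
        using cont[OF that] by (rule continuous_on_subset) auto
      have "(\<exists>z\<in>{l<..<u}. f a z = f c z) \<or> (\<exists>z\<in>{l<..<u}. f b z = f c z)"
      proof (cases "f c x \<le> f b x")
        case True
        then have "\<exists>z\<in>{l<..<u}. min p x \<le> z \<and> z \<le> max p x \<and> f b z = f c z"
          using c x p bA by (intro crossing_between) (auto simp: M_def contc is_interval_1)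
        then show ?thesis by blast
      next
        case False
        then have "\<exists>z\<in>{l<..<u}. min p x \<le> z \<and> z \<le> max p x \<and> f c z = f a z"
          using c x p aA gt by (intro crossing_between) (auto simp: M_def contc is_interval_1)
        then show ?thesis by force
      qed
      then show "c \<in> N a \<union> N b" using c by (auto simp: N_def M_def)
    qed
    then have "card M \<le> card (N a) + card (N b)"
      using card_mono[of "N a \<union> N b" M] card_Un_le[of "N a" "N b"] finN by (meson finite_UnI le_trans)
    ultimately show False using aA bA by linarith
  qed
  \<comment> \<open>Crossings are counted in open strips, but the closed strips have to cover [0,1];
    continuity carries the order to the ends.\<close>
  have "\<forall>a\<in>A - E. \<forall>b\<in>K. \<forall>x\<in>{l..u}. f b x \<le> f a x"
  proof (intro ballI)
    fix a b x assume *: "a \<in> A - E" "b \<in> K" "x \<in> {l..u}"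
    show "f b x \<le> f a x"
      by (rule le_on_closed_interval[OF lu _ _ open_le[OF *(1,2)] *(3)])
        (use * in \<open>auto simp: K_def cont\<close>)
  qed
  moreover have "K \<subseteq> A" "E \<subseteq> A" by (auto simp: K_def E_def Bad_def)
  ultimately show ?thesis using cK cE by blast
qed

section \<open>Ranks along pseudolines and the intervals of low rank\<close>

text \<open>Ties count towards the rank, so that at most \<open>j\<close> curves have rank below \<open>j\<close> at any
  point, even where many curves are concurrent.\<close>

definition weak_rank :: "('b \<Rightarrow> real \<Rightarrow> real) \<Rightarrow> 'b set \<Rightarrow> 'b \<Rightarrow> real \<Rightarrow> nat" where
  "weak_rank g B b x = card {c\<in>B - {b}. g c x \<le> g b x}"

text \<open>This is the convex hull of the points of [0,1] where \<open>b\<close> has rank below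
  \<open>r\<close>. Those points may form many pieces; the hull has only two ends, so few cuts
  suffice.\<close>

definition low_hull :: "('b \<Rightarrow> real \<Rightarrow> real) \<Rightarrow> 'b set \<Rightarrow> nat \<Rightarrow> 'b \<Rightarrow> real set" where
  "low_hull g B r b = {x. \<exists>p\<in>{0..1}. \<exists>q\<in>{0..1}. p \<le> x \<and> x \<le> q \<and>
     weak_rank g B b p < r \<and> weak_rank g B b q < r}"

lemma low_hull_subset: "low_hull g B r b \<subseteq> {0..1}"
  by (auto simp: low_hull_def)

lemma low_hull_between:
  assumes "x \<in> low_hull g B r b" "z \<in> low_hull g B r b" "x \<le> y" "y \<le> z"
  shows "y \<in> low_hull g B r b"
proof -
  obtain p where "p \<in> {0..1}" "p \<le> x" "weak_rank g B b p < r"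
    using assms(1) by (auto simp: low_hull_def)
  moreover obtain q where "q \<in> {0..1}" "z \<le> q" "weak_rank g B b q < r"
    using assms(2) by (auto simp: low_hull_def)
  ultimately show ?thesis
    using assms(3,4) unfolding low_hull_def by (blast intro: order_trans)
qed

lemma low_hullI: "x \<in> {0..1} \<Longrightarrow> weak_rank g B b x < r \<Longrightarrow> x \<in> low_hull g B r b"
  unfolding low_hull_def by blast

text \<open>Hysteresis: a curve above \<open>b\<close> at both ends of an interval stays above \<open>b\<close> inside it, so the
  curves counted at an inner point are counted at one of the two ends.\<close>

lemma weak_rank_low_hull:
  assumes fin: "finite B"
    and conv: "\<And>b c. b \<in> B \<Longrightarrow> c \<in> B \<Longrightarrow> b \<noteq> c \<Longrightarrow> is_interval {x\<in>{0..1}. g b x < g c x}"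
    and b: "b \<in> B" and y: "y \<in> low_hull g B r b"
  shows "weak_rank g B b y < 2 * r"
proof -
  obtain x z where xz: "x \<in> {0..1}" "z \<in> {0..1}" "x \<le> y" "y \<le> z"
    "weak_rank g B b x < r" "weak_rank g B b z < r"
    using y by (auto simp: low_hull_def)
  define W where "W t = {c\<in>B - {b}. g c t \<le> g b t}" for t
  have finW: "finite (W t)" for t using fin by (simp add: W_def)
  have "W y \<subseteq> W x \<union> W z"
  proof
    fix c assume c: "c \<in> W y"
    show "c \<in> W x \<union> W z"
    proof (rule ccontr)
      assume "c \<notin> W x \<union> W z"
      then have "x \<in> {t\<in>{0..1}. g b t < g c t}" "z \<in> {t\<in>{0..1}. g b t < g c t}"
        using c xz by (auto simp: W_def)
      moreover have "is_interval {t\<in>{0..1}. g b t < g c t}"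
        using c by (intro conv b) (auto simp: W_def)
      ultimately have "y \<in> {t\<in>{0..1}. g b t < g c t}"
        using xz(3,4) unfolding is_interval_1 by blast
      then show False using c by (auto simp: W_def)
    qed
  qed
  then have "card (W y) \<le> card (W x) + card (W z)"
    using card_mono[of "W x \<union> W z" "W y"] card_Un_le[of "W x" "W z"] finW
    by (meson finite_UnI le_trans)
  then show ?thesis using xz(5,6) unfolding weak_rank_def W_def by linarith
qed

text \<open>Phrased through \<open>Inf\<close> and \<open>Sup\<close> so that the ends of a hull
  become real values to which \<open>cut_points_exist\<close> applies.\<close>

lemma interval_meets_or_contained:
  fixes J :: "real set"
  assumes "\<And>x y z. x \<in> J \<Longrightarrow> z \<in> J \<Longrightarrow> x \<le> y \<Longrightarrow> y \<le> z \<Longrightarrow> y \<in> J" "bdd_below J" "bdd_above J"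
    and "Inf J \<notin> {l<..<u}" "Sup J \<notin> {l<..<u}"
  shows "J \<inter> {l<..<u} = {} \<or> {l<..<u} \<subseteq> J"
proof (rule ccontr)
  assume "\<not> ?thesis"
  then obtain x y where xy: "x \<in> J" "x \<in> {l<..<u}" "y \<in> {l<..<u}" "y \<notin> J" by blast
  show False
  proof (cases "y < x")
    case True
    have "y \<le> j" if "j \<in> J" for j using assms(1)[OF that xy(1), of y] xy(4) True by linarith
    then have "y \<le> Inf J" using xy(1) by (intro cInf_greatest) auto
    moreover have "Inf J \<le> x" using xy(1) assms(2) by (rule cInf_lower)
    ultimately show False using xy assms(4) by auto
  next
    case False
    have "j \<le> y" if "j \<in> J" for j using assms(1)[OF xy(1) that, of y] xy(4) False by linarith
    then have "Sup J \<le> y" using xy(1) by (intro cSup_least) auto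
    moreover have "x \<le> Sup J" using xy(1) assms(3) by (rule cSup_upper)
    ultimately show False using xy assms(5) by auto
  qed
qed

text \<open>In an index \<open>(b, v, s)\<close> the flag \<open>v\<close> selects one of the two thresholds and \<open>s\<close> the right
  end; for an empty hull the value is junk and harmless.\<close>

definition hull_ends :: "('b \<Rightarrow> real \<Rightarrow> real) \<Rightarrow> 'b set \<Rightarrow> nat \<Rightarrow> 'b \<times> bool \<times> bool \<Rightarrow> real" where
  "hull_ends g B h = (\<lambda>(b, v, s). (if s then Sup else Inf) (low_hull g B (if v then 4 * h else 2 * h) b))"

text \<open>For each threshold at most \<open>h\<close> curves have a hull ending inside the strip;
  every other hull contains the strip or misses it. Of the curves of rank below \<open>2 * h\<close>
  at a crossing-free point, at least \<open>h\<close> therefore have a hull containing the whole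
  strip, hence rank below \<open>4 * h\<close> throughout. A curve running below one of these at
  some point has rank below \<open>4 * h\<close> there and lies in \<open>E\<close>. Up to
  \<open>h\<close> curves with an end in the strip, the members of \<open>E\<close> have rank below
  \<open>8 * h\<close> at the chosen point.\<close>

lemma low_separator_if_few_hull_ends:
  fixes g :: "'b \<Rightarrow> real \<Rightarrow> real"
  assumes fin: "finite B" and lu: "l < u" "{l..u} \<subseteq> {0..1}"
    and cont: "\<And>b. b \<in> B \<Longrightarrow> continuous_on {0..1} (g b)"
    and fin_cross: "\<And>b c. b \<in> B \<Longrightarrow> c \<in> B \<Longrightarrow> b \<noteq> c \<Longrightarrow> finite {x\<in>{0..1}. g b x = g c x}"
    and conv: "\<And>b c. b \<in> B \<Longrightarrow> c \<in> B \<Longrightarrow> b \<noteq> c \<Longrightarrow> is_interval {x\<in>{0..1}. g b x < g c x}"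
    and ends: "card {i\<in>B \<times> UNIV. hull_ends g B h i \<in> {l<..<u}} \<le> h"
    and h: "2 * h \<le> card B"
    and E: "E = {b\<in>B. low_hull g B (4 * h) b \<inter> {l<..<u} \<noteq> {}}"
  shows "card E \<le> 9 * h \<and> (\<exists>K\<subseteq>B. h \<le> card K \<and>
    (\<forall>b\<in>B - E. \<forall>c\<in>K. \<forall>x\<in>{l..u}. g c x \<le> g b x))"
proof -
  define C where "C = (\<Union>b\<in>B. \<Union>c\<in>B - {b}. {x\<in>{0..1}. g b x = g c x})"
  have "finite C" unfolding C_def using fin fin_cross by auto
  then have "infinite ({l<..<u} - C)" using lu by (intro Diff_infinite_finite) auto
  then obtain p where p: "p \<in> {l<..<u}" "p \<notin> C"
    by (metis DiffE finite.emptyI ex_in_conv)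
  have p01: "p \<in> {0..1}" using p lu(2) by auto
  have inj: "inj_on (\<lambda>b. g b p) B" using p(2) p01 by (auto simp: inj_on_def C_def)
  have rank_lt: "weak_rank g B b y < 2 * r" if "b \<in> B" "y \<in> low_hull g B r b" for b y r
    by (rule weak_rank_low_hull[OF fin _ that]) (rule conv)
  define J where "J v = low_hull g B (if v then 4 * h else 2 * h)" for v
  define V where "V v = {b\<in>B. Inf (J v b) \<in> {l<..<u} \<or> Sup (J v b) \<in> {l<..<u}}" for v
  have finV: "finite (V v)" for v using fin by (simp add: V_def)
  have cV: "card (V v) \<le> h" for v
  proof -
    define X where "X = {i\<in>B \<times> UNIV. hull_ends g B h i \<in> {l<..<u}}"
    have finX: "finite X" using fin by (simp add: X_def)
    have "V v \<subseteq> fst ` X"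
    proof
      fix b assume "b \<in> V v"
      then have "b \<in> B" "hull_ends g B h (b, v, False) \<in> {l<..<u} \<or> hull_ends g B h (b, v, True) \<in> {l<..<u}"
        by (cases v; simp add: V_def hull_ends_def J_def)+
      then obtain s where "(b, v, s) \<in> X" unfolding X_def by blast
      then show "b \<in> fst ` X"
        by (rule image_eqI[rotated]) simp
    qed
    then have "card (V v) \<le> card (fst ` X)" using finX by (intro card_mono) auto
    also have "\<dots> \<le> card X" using finX by (rule card_image_le)
    finally show ?thesis using ends by (simp add: X_def)
  qed
  have dich: "J v b \<inter> {l<..<u} = {} \<or> {l<..<u} \<subseteq> J v b" if "b \<in> B - V v" for v b
  proof (rule interval_meets_or_contained)
    show "bdd_below (J v b)" "bdd_above (J v b)"
      using low_hull_subset unfolding J_def by (meson bdd_below_Icc bdd_below_mono bdd_above_Icc bdd_above_mono)+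
  qed (use that low_hull_between in \<open>auto simp: V_def J_def\<close>)
  define K where "K = {b\<in>B. {l<..<u} \<subseteq> J False b}"
  have "2 * h \<le> card {b\<in>B. weak_rank g B b p < 2 * h}"
    unfolding weak_rank_def by (rule card_low_rank_ge[OF fin inj h])
  also have "\<dots> \<le> card (K \<union> V False)"
  proof (rule card_mono)
    show "{b\<in>B. weak_rank g B b p < 2 * h} \<subseteq> K \<union> V False"
    proof
      fix b assume b: "b \<in> {b\<in>B. weak_rank g B b p < 2 * h}"
      then have "p \<in> J False b" using p01 by (auto simp: J_def intro: low_hullI)
      then show "b \<in> K \<union> V False" using dich[of b False] b p(1) unfolding K_def by blast
    qed
  qed (use fin finV in \<open>auto simp: K_def\<close>)
  also have "\<dots> \<le> card K + card (V False)" by (rule card_Un_le)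
  finally have cK: "h \<le> card K" using cV[of False] by simp
  have "E \<subseteq> {b\<in>B. weak_rank g B b p < 8 * h} \<union> V True"
  proof
    fix b assume b: "b \<in> E"
    show "b \<in> {b\<in>B. weak_rank g B b p < 8 * h} \<union> V True"
    proof (cases "b \<in> V True")
      case False
      then have "p \<in> low_hull g B (4 * h) b" using dich[of b True] b p(1) by (auto simp: E J_def)
      then show ?thesis using rank_lt[of b p "4 * h"] b by (auto simp: E)
    qed simp
  qed
  then have "card E \<le> card ({b\<in>B. weak_rank g B b p < 8 * h} \<union> V True)"
    using fin finV by (intro card_mono) auto
  also have "\<dots> \<le> card {b\<in>B. weak_rank g B b p < 8 * h} + card (V True)" by (rule card_Un_le)
  also have "card {b\<in>B. weak_rank g B b p < 8 * h} \<le> 8 * h"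
    unfolding weak_rank_def by (rule card_low_rank_le[OF fin])
  finally have cE: "card E \<le> 9 * h" using cV[of True] by simp
  have open_le: "g c x \<le> g b x" if b: "b \<in> B - E" and c: "c \<in> K" and x: "x \<in> {l<..<u}" for b c x
  proof (rule ccontr)
    assume gt: "\<not> g c x \<le> g b x"
    have x01: "x \<in> {0..1}" using x lu(2) by auto
    have "x \<in> low_hull g B (2 * h) c" using c x by (auto simp: K_def J_def)
    then have "weak_rank g B c x < 4 * h"
      using rank_lt[of c x "2 * h"] c by (auto simp: K_def)
    moreover have "weak_rank g B b x \<le> weak_rank g B c x"
    proof -
      \<comment> \<open>\<open>c\<close> does not occur on the left because it runs strictly above
        \<open>b\<close> at \<open>x\<close>, so removing it on the right costs nothing.\<close>
      have "{e\<in>B - {b}. g e x \<le> g b x} \<subseteq> {e\<in>B - {c}. g e x \<le> g c x}" using gt by auto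
      then show ?thesis unfolding weak_rank_def using fin by (intro card_mono) auto
    qed
    ultimately have "x \<in> low_hull g B (4 * h) b" using x01 by (auto intro: low_hullI)
    then show False using b x by (auto simp: E)
  qed
  have "\<forall>b\<in>B - E. \<forall>c\<in>K. \<forall>x\<in>{l..u}. g c x \<le> g b x"
  proof (intro ballI)
    fix b c x assume *: "b \<in> B - E" "c \<in> K" "x \<in> {l..u}"
    show "g c x \<le> g b x"
      by (rule le_on_closed_interval[OF lu(1) _ _ open_le[OF *(1,2)] *(3)])
        (use * in \<open>auto simp: K_def intro!: continuous_on_subset[OF cont lu(2)]\<close>)
  qed
  moreover have "K \<subseteq> B" by (auto simp: K_def)
  ultimately show ?thesis using cE cK by blast
qed

section \<open>From separating curves in all strips to the two subfamilies\<close>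

lemma pigeonhole_fibre:
  assumes "finite X" "\<And>x. x \<in> X \<Longrightarrow> \<exists>s<m. P s x" "m * w \<le> card X" "m > 0"
  shows "\<exists>s<m. w \<le> card {x\<in>X. P s x}"
proof (rule ccontr)
  assume "\<not> ?thesis"
  then have lt: "card {x\<in>X. P s x} < w" if "s < m" for s using that by auto
  have "card X \<le> card (\<Union>s<m. {x\<in>X. P s x})"
    using assms(1,2) by (intro card_mono) auto
  also have "\<dots> \<le> (\<Sum>s<m. card {x\<in>X. P s x})" by (rule card_UN_le) simp
  also have "\<dots> < (\<Sum>s<m. w)" using assms(4) lt by (intro sum_strict_mono) auto
  finally show False using assms(3) by simp
qed

text \<open>The two families enter differently. Each \<open>EA s\<close> is small, so even 108 of
  them together leave most of \<open>A\<close>. The sets \<open>EB s\<close> are small only on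
  average, but the strips where a fixed \<open>b\<close> is exceptional are consecutive, so for a
  typical \<open>b\<close> a window of 108 strips contains them all.\<close>

lemma strips_to_biclique:
  fixes f :: "'a \<Rightarrow> real \<Rightarrow> real" and g :: "'b \<Rightarrow> real \<Rightarrow> real"
  assumes fin: "finite A" "finite B" and card: "card A = N" "card B = N"
    and m: "m > 0" "4 * (m * w) \<le> N" and e: "4 * (108 * e) \<le> N" and N: "N > 0"
    and cover: "\<And>x. x \<in> {0..1} \<Longrightarrow> \<exists>s<m. x \<in> I s" and sub: "\<And>s. s < m \<Longrightarrow> I s \<subseteq> {0..1}"
    and contf: "\<And>a. a \<in> A \<Longrightarrow> continuous_on {0..1} (f a)"
    and contg: "\<And>b. b \<in> B \<Longrightarrow> continuous_on {0..1} (g b)"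
    and start: "\<And>a b. a \<in> A \<Longrightarrow> b \<in> B \<Longrightarrow> f a 0 \<le> g b 0"
    and KA: "\<And>s. s < m \<Longrightarrow> KA s \<subseteq> A \<and> w \<le> card (KA s)"
    and EA: "\<And>s. s < m \<Longrightarrow> EA s \<subseteq> A \<and> card (EA s) \<le> e"
    and above: "\<And>s a a' x. s < m \<Longrightarrow> a \<in> A - EA s \<Longrightarrow> a' \<in> KA s \<Longrightarrow> x \<in> I s \<Longrightarrow> f a x \<le> f a' x"
    and KB: "\<And>s. s < m \<Longrightarrow> KB s \<subseteq> B \<and> w \<le> card (KB s)"
    and EB: "(\<Sum>s<m. card (EB s)) \<le> 54 * N" "\<And>s. s < m \<Longrightarrow> EB s \<subseteq> B"
    and EB_between: "\<And>s s' s'' b. s \<le> s' \<Longrightarrow> s' \<le> s'' \<Longrightarrow> s'' < m \<Longrightarrow> b \<in> EB s \<Longrightarrow> b \<in> EB s'' \<Longrightarrow> b \<in> EB s'"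
    and below: "\<And>s b b' x. s < m \<Longrightarrow> b \<in> B - EB s \<Longrightarrow> b' \<in> KB s \<Longrightarrow> x \<in> I s \<Longrightarrow> g b' x \<le> g b x"
  shows "\<exists>A0\<subseteq>A. \<exists>B0\<subseteq>B. w \<le> card A0 \<and> w \<le> card B0 \<and>
    ((\<forall>a\<in>A0. \<forall>b\<in>B0. \<exists>x\<in>{0..1}. f a x = g b x) \<or>
     (\<forall>a\<in>A0. \<forall>b\<in>B0. \<forall>x\<in>{0..1}. f a x \<noteq> g b x))"
proof -
  have meet: "\<exists>x\<in>{0..1}. f a x = g b x"
    if "a \<in> A" "b \<in> B" "y \<in> {0..1}" "g b y \<le> f a y" for a b y
    using crossing_between[OF contf[OF that(1)] contg[OF that(2)] is_interval_cc _ that(3) start[OF that(1,2)] that(4)]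
    by auto
  \<comment> \<open>One point of the strip has to serve for all separating curves. The negation then
    supplies, at each point of the strip, a separating curve on the right side, which may vary with
    the point.\<close>
  define low where "low s b \<longleftrightarrow> (\<exists>x\<in>I s. \<forall>a\<in>KA s. g b x \<le> f a x)" for s b
  define high where "high s a \<longleftrightarrow> (\<exists>x\<in>I s. \<forall>b\<in>KB s. g b x \<le> f a x)" for s a
  define LB where "LB = {b\<in>B. \<exists>s<m. low s b}"
  define HA where "HA = {a\<in>A. \<exists>s<m. high s a}"
  have finLB: "finite LB" and finHA: "finite HA" using fin by (simp_all add: LB_def HA_def)
  show ?thesis
  proof (cases "m * w \<le> card LB \<or> m * w \<le> card HA")
    case True
    then show ?thesis
    proof
      assume "m * w \<le> card LB"
      then obtain s where s: "s < m" "w \<le> card {b\<in>LB. low s b}"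
        using pigeonhole_fibre[OF finLB, of m low w] m(1) by (auto simp: LB_def)
      have "\<exists>x\<in>{0..1}. f a x = g b x" if ab: "a \<in> KA s" "b \<in> {b\<in>LB. low s b}" for a b
      proof -
        obtain y where "y \<in> I s" "g b y \<le> f a y" using ab unfolding low_def by blast
        then show ?thesis using ab KA[OF s(1)] sub[OF s(1)] by (intro meet[of a b y]) (auto simp: LB_def)
      qed
      then show ?thesis using s(2) KA[OF s(1)]
        by (intro exI[of _ "KA s"] conjI exI[of _ "{b\<in>LB. low s b}"] disjI1) (auto simp: LB_def)
    next
      assume "m * w \<le> card HA"
      then obtain s where s: "s < m" "w \<le> card {a\<in>HA. high s a}"
        using pigeonhole_fibre[OF finHA, of m high w] m(1) by (auto simp: HA_def)
      have "\<exists>x\<in>{0..1}. f a x = g b x" if ab: "b \<in> KB s" "a \<in> {a\<in>HA. high s a}" for a b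
      proof -
        obtain y where "y \<in> I s" "g b y \<le> f a y" using ab unfolding high_def by blast
        then show ?thesis using ab KB[OF s(1)] sub[OF s(1)] by (intro meet[of a b y]) (auto simp: HA_def)
      qed
      then show ?thesis using s(2) KB[OF s(1)]
        by (intro exI[of _ "{a\<in>HA. high s a}"] conjI exI[of _ "KB s"] disjI1) (auto simp: HA_def)
    qed
  next
    case False
    \<comment> \<open>On average a curve lies in 54 of the sets \<open>EB s\<close>, so half of the curves lie in fewer than 108,
      and these are consecutive; many curves share the first one.\<close>
    define S where "S b = {s\<in>{..<m}. b \<in> EB s}" for b
    define Many where "Many = {b\<in>B. 108 \<le> card (S b)}"
    have finMany: "finite Many" using fin by (simp add: Many_def)
    have "card Many * 108 \<le> (\<Sum>b\<in>Many. card (S b))"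
      using sum_bounded_below[of Many 108 "\<lambda>b. card (S b)"] by (auto simp: Many_def)
    also have "\<dots> \<le> (\<Sum>b\<in>B. card (S b))"
      using fin by (intro sum_mono2) (auto simp: Many_def)
    also have "\<dots> = (\<Sum>b\<in>B. \<Sum>s<m. if b \<in> EB s then 1 else 0)"
      unfolding S_def by (intro sum.cong refl) (simp flip: sum.inter_filter)
    also have "\<dots> = (\<Sum>s<m. \<Sum>b\<in>B. if b \<in> EB s then 1 else 0)" by (rule sum.swap)
    also have "\<dots> = (\<Sum>s<m. card (EB s))"
    proof (rule sum.cong[OF refl])
      fix s assume "s \<in> {..<m}"
      then have "{b\<in>B. b \<in> EB s} = EB s" using EB(2) by auto
      then show "(\<Sum>b\<in>B. if b \<in> EB s then 1 else 0) = card (EB s)"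
        using fin by (simp flip: sum.inter_filter)
    qed
    finally have cMany: "2 * card Many \<le> N" using EB(1) by linarith
    define B1 where "B1 = B - (LB \<union> Many)"
    \<comment> \<open>Fewer than N/4 curves are lost to \<open>LB\<close> and at most N/2 to
      \<open>Many\<close>; what remains is at least N/4, hence at least
      \<open>m * w\<close>.\<close>
    have "card (LB \<union> Many) \<le> card LB + card Many" by (rule card_Un_le)
    moreover have "card B - card (LB \<union> Many) \<le> card B1"
      unfolding B1_def by (rule diff_card_le_card_Diff) (simp add: finLB finMany)
    ultimately have cB1: "m * w \<le> card B1" using False m card cMany by linarith
    have finB1: "finite B1" using fin by (simp add: B1_def)
    \<comment> \<open>A curve that is exceptional nowhere is filed under strip 0. This is harmless,
      as no strip then has to be placed in the window \<open>T\<close>.\<close>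
    define first where "first b = (if S b = {} then 0 else Min (S b))" for b
    have first_lt: "first b < m" for b
    proof (cases "S b = {}")
      case False
      then have "Min (S b) \<in> S b" by (intro Min_in) (auto simp: S_def)
      then show ?thesis using False by (simp add: first_def S_def)
    qed (simp add: first_def m)
    obtain s0 where s0: "s0 < m" "w \<le> card {b\<in>B1. first b = s0}"
      using pigeonhole_fibre[OF finB1 _ cB1 m(1), of "\<lambda>s b. first b = s"] first_lt by auto
    define B0 where "B0 = {b\<in>B1. first b = s0}"
    define T where "T = {s. s0 \<le> s \<and> s < s0 + 108 \<and> s < m}"
    have ST: "s \<in> T" if b: "b \<in> B0" and s: "s \<in> S b" for b s
    proof -
      have fS: "finite (S b)" by (simp add: S_def)
      have ne: "S b \<noteq> {}" using s by auto
      have eq: "s0 = Min (S b)" using b ne by (simp add: B0_def first_def)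
      have s0S: "s0 \<in> S b" unfolding eq using fS ne by (rule Min_in)
      have le: "s0 \<le> s" unfolding eq using fS s by (rule Min_le)
      have "{s0..s} \<subseteq> S b" using EB_between[of s0 _ s b] s s0S by (auto simp: S_def)
      then have "card {s0..s} \<le> card (S b)" using fS by (intro card_mono)
      also have "\<dots> < 108" using b by (auto simp: B0_def B1_def Many_def)
      finally show ?thesis using le s by (auto simp: T_def S_def)
    qed
    have cT: "card (\<Union>s\<in>T. EA s) \<le> 108 * e"
    proof -
      have sub: "T \<subseteq> {s0..<s0 + 108}" by (auto simp: T_def)
      have finT: "finite T" using sub by (rule finite_subset) simp
      have "card (\<Union>s\<in>T. EA s) \<le> (\<Sum>s\<in>T. card (EA s))" by (rule card_UN_le[OF finT])
      also have "\<dots> \<le> (\<Sum>s\<in>T. e)" using EA by (intro sum_mono) (simp add: T_def)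
      also have "\<dots> = card T * e" by simp
      also have "\<dots> \<le> 108 * e" using card_mono[OF _ sub] by (intro mult_right_mono) auto
      finally show ?thesis .
    qed
    define A0 where "A0 = A - (HA \<union> (\<Union>s\<in>T. EA s))"
    \<comment> \<open>Fewer than N/4 curves are lost to \<open>HA\<close> and at most N/4 to the
      exceptional sets of the window.\<close>
    have cA0: "w \<le> card A0"
    proof -
      have "card (HA \<union> (\<Union>s\<in>T. EA s)) \<le> card HA + card (\<Union>s\<in>T. EA s)"
        by (rule card_Un_le)
      moreover have "card A - card (HA \<union> (\<Union>s\<in>T. EA s)) \<le> card A0"
        unfolding A0_def by (rule diff_card_le_card_Diff) (use fin finHA EA in \<open>auto simp: T_def intro: finite_subset\<close>)
      moreover have "w \<le> m * w" using m(1) by simp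
      ultimately show ?thesis using False m card e cT by linarith
    qed
    have "f a x \<noteq> g b x" if a: "a \<in> A0" and b: "b \<in> B0" and x: "x \<in> {0..1}" for a b x
    proof -
      obtain s where s: "s < m" "x \<in> I s" using cover[OF x] by auto
      have nl: "\<not> low s b" using b s(1) by (auto simp: B0_def B1_def LB_def)
      have nh: "\<not> high s a" using a s(1) by (auto simp: A0_def HA_def)
      show ?thesis
      \<comment> \<open>In fact \<open>a\<close> runs strictly below \<open>b\<close>: inside the
        window a top curve of \<open>A\<close> separates them, elsewhere a bottom curve of
        \<open>B\<close> does.\<close>
      proof (cases "s \<in> T")
        case True
        then have aE: "a \<in> A - EA s" using a by (auto simp: A0_def)
        obtain a' where "a' \<in> KA s" "f a' x < g b x" using nl s(2) by (auto simp: low_def not_le)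
        then show ?thesis using above[OF s(1) aE _ s(2), of a'] by linarith
      next
        case False
        then have "s \<notin> S b" using ST[OF b] by blast
        then have bE: "b \<in> B - EB s" using b s(1) by (auto simp: B0_def B1_def S_def)
        obtain b' where "b' \<in> KB s" "f a x < g b' x" using nh s(2) by (auto simp: high_def not_le)
        then show ?thesis using below[OF s(1) bE _ s(2), of b'] by linarith
      qed
    qed
    then show ?thesis using cA0 s0(2)
      by (intro exI[of _ A0] conjI exI[of _ B0] disjI2) (auto simp: A0_def B0_def B1_def)
  qed
qed

section \<open>Choice of the strips and of the parameters\<close>

lemma ex_subsets_mono:
  assumes "\<exists>X\<subseteq>A'. \<exists>Y\<subseteq>B'. Q X Y" "A' \<subseteq> A" "B' \<subseteq> B"
  shows "\<exists>X\<subseteq>A. \<exists>Y\<subseteq>B. Q X Y"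
  using assms by (meson subset_trans)

lemma consecutive_gaps:
  fixes P :: "real set"
  assumes "finite P" "P \<subseteq> {0..1}" "0 \<in> P" "1 \<in> P"
  obtains t m where "card P = Suc m" "m > 0" "\<And>i j. i < j \<Longrightarrow> j \<le> m \<Longrightarrow> t i < t j"
    "\<And>i. i \<le> m \<Longrightarrow> t i \<in> {0..1}"
    "\<And>s. s < m \<Longrightarrow> P \<inter> {t s<..<t (Suc s)} = {}"
    "\<And>x. x \<in> {0..1} \<Longrightarrow> \<exists>s<m. x \<in> {t s..t (Suc s)}"
proof -
  define xs where "xs = sorted_list_of_set P"
  have set: "set xs = P" and len: "length xs = card P" and srt: "sorted_wrt (<) xs"
    using assms(1) by (simp_all add: xs_def strict_sorted_list_of_set)
  have "card {0::real, 1} \<le> card P" using assms by (intro card_mono) auto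
  then have c2: "2 \<le> card P" by simp
  define m where "m = card P - 1"
  have lm: "length xs = Suc m" using len c2 by (simp add: m_def)
  have less: "xs ! i < xs ! j" if "i < j" "j \<le> m" for i j
    using sorted_wrt_nth_less[OF srt that(1)] that lm by simp
  have le: "xs ! i \<le> xs ! j" if "i \<le> j" "j \<le> m" for i j
    using less[of i j] that by (cases "i = j") auto
  have ex: "\<exists>i\<le>m. p = xs ! i" if "p \<in> P" for p
    using that set lm by (metis in_set_conv_nth less_Suc_eq_le)
  have mem: "xs ! i \<in> P" if "i \<le> m" for i using that set lm by (metis less_Suc_eq_le nth_mem)
  have mem01: "xs ! i \<in> {0..1}" if "i \<le> m" for i using mem[OF that] assms(2) by auto
  have gap: "P \<inter> {xs ! s<..<xs ! Suc s} = {}" if "s < m" for s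
  proof (rule ccontr)
    assume "\<not> ?thesis"
    then obtain i where i: "i \<le> m" "xs ! s < xs ! i" "xs ! i < xs ! Suc s" using ex by fastforce
    show False using le[of i s] le[of "Suc s" i] i that by (cases "i \<le> s") auto
  qed
  have cover: "\<exists>s<m. x \<in> {xs ! s..xs ! Suc s}" if x: "x \<in> {0..1}" for x
  proof -
    obtain j where j: "j \<le> m" "x \<le> xs ! j" using ex[OF assms(4)] x by auto
    define i where "i = (LEAST i. x \<le> xs ! i)"
    have i: "x \<le> xs ! i" unfolding i_def by (rule LeastI[of "\<lambda>i. x \<le> xs ! i"]) (rule j(2))
    have ij: "i \<le> j" unfolding i_def using j(2) by (rule Least_le)
    show ?thesis
    proof (cases i)
      case 0
      \<comment> \<open>Here \<open>x\<close> is the first cut point 0, with no strip on its left,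
        so strip 0 is taken; it exists because \<open>P\<close> has at least two points.\<close>
      obtain z where "z \<le> m" "0 = xs ! z" using ex[OF assms(3)] by auto
      then have "xs ! 0 \<le> x" using le[of 0 z] x by auto
      moreover have "x \<le> xs ! Suc 0" 
      proof -
        have "Suc 0 \<le> m" using c2 by (simp add: m_def)
        then show ?thesis using i le[of 0 "Suc 0"] 0 by simp
      qed
      ultimately show ?thesis using c2 by (intro exI[of _ 0]) (simp add: m_def)
    next
      case (Suc s)
      then have "\<not> x \<le> xs ! s" using not_less_Least[of s "\<lambda>i. x \<le> xs ! i"] by (simp add: i_def)
      then show ?thesis using i Suc ij j(1) by (intro exI[of _ s]) auto
    qed
  qed
  show ?thesis
    by (rule that[of m "\<lambda>i. xs ! i"]) (use c2 less gap cover mem01 in \<open>simp_all add: m_def\<close>)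
qed

text \<open>The cuts for both families are merged, so that one sequence of strips suits both
  separator lemmas. Passing to subfamilies of one exact size lets the numerical bounds come out
  exactly.\<close>

lemma biclique_if_ordered_at_0:
  fixes f :: "'a \<Rightarrow> real \<Rightarrow> real" and g :: "'b \<Rightarrow> real \<Rightarrow> real"
  assumes kw: "k > 0" "w > 0"
    and fin: "finite A" "finite B"
    and card_ge: "111974400 * k * w \<le> card A" "111974400 * k * w \<le> card B"
    and contf: "\<And>a. a \<in> A \<Longrightarrow> continuous_on {0..1} (f a)"
    and contg: "\<And>b. b \<in> B \<Longrightarrow> continuous_on {0..1} (g b)"
    and start: "\<And>a b. a \<in> A \<Longrightarrow> b \<in> B \<Longrightarrow> f a 0 \<le> g b 0"
    and crossA: "\<And>a b. a \<in> A \<Longrightarrow> b \<in> A \<Longrightarrow> a \<noteq> b \<Longrightarrow>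
        finite {x\<in>{0..1}. f a x = f b x} \<and> card {x\<in>{0..1}. f a x = f b x} \<le> k"
    and crossB: "\<And>b c. b \<in> B \<Longrightarrow> c \<in> B \<Longrightarrow> b \<noteq> c \<Longrightarrow> finite {x\<in>{0..1}. g b x = g c x}"
    and conv: "\<And>b c. b \<in> B \<Longrightarrow> c \<in> B \<Longrightarrow> b \<noteq> c \<Longrightarrow> is_interval {x\<in>{0..1}. g b x < g c x}"
  shows "\<exists>A0\<subseteq>A. \<exists>B0\<subseteq>B. w \<le> card A0 \<and> w \<le> card B0 \<and>
    ((\<forall>a\<in>A0. \<forall>b\<in>B0. \<exists>x\<in>{0..1}. f a x = g b x) \<or>
     (\<forall>a\<in>A0. \<forall>b\<in>B0. \<forall>x\<in>{0..1}. f a x \<noteq> g b x))"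
proof -
  \<comment> \<open>With \<open>c = 2160\<^sup>2\<close> we have \<open>N = c k h = 2160 d\<close>; there are at most \<open>N\<^sup>2 k / d\<^sup>2 = c k\<close> cut points
    for the crossings and \<open>4 N / h = 4 c k\<close> for the hull ends, hence at most \<open>6 c k\<close> strips.\<close>
  define N where "N = 111974400 * k * w"
  define d where "d = 51840 * k * w"
  define h where "h = 24 * w"
  obtain A' where A': "A' \<subseteq> A" "card A' = N"
    using obtain_subset_with_card_n[OF card_ge(1)] unfolding N_def by metis
  obtain B' where B': "B' \<subseteq> B" "card B' = N"
    using obtain_subset_with_card_n[OF card_ge(2)] unfolding N_def by metis
  have finA': "finite A'" and finB': "finite B'" using A' B' fin finite_subset by auto
  \<comment> \<open>Ordered pairs are used, as in the set \<open>Z\<close> of the separator lemma,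
    so every crossing is counted twice.\<close>
  define ZA where "ZA = (SIGMA p:{p\<in>A' \<times> A'. fst p \<noteq> snd p}. {x\<in>{0..1}. f (fst p) x = f (snd p) x})"
  have crossA': "finite {x\<in>{0..1}. f (fst p) x = f (snd p) x} \<and>
      card {x\<in>{0..1}. f (fst p) x = f (snd p) x} \<le> k"
    if "p \<in> {p\<in>A' \<times> A'. fst p \<noteq> snd p}" for p
    using that A'(1) by (intro crossA) auto
  have finpairs: "finite {p\<in>A' \<times> A'. fst p \<noteq> snd p}" using finA' by simp
  have finZA: "finite ZA" unfolding ZA_def using crossA' finpairs by (intro finite_SigmaI) auto
  have "card ZA = (\<Sum>p\<in>{p\<in>A' \<times> A'. fst p \<noteq> snd p}. card {x\<in>{0..1}. f (fst p) x = f (snd p) x})"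
    unfolding ZA_def using crossA' finpairs by (subst card_SigmaI) auto
  also have "\<dots> \<le> (\<Sum>p\<in>{p\<in>A' \<times> A'. fst p \<noteq> snd p}. k)"
    using crossA' by (intro sum_mono) blast
  also have "\<dots> = card {p\<in>A' \<times> A'. fst p \<noteq> snd p} * k" by simp
  also have "\<dots> \<le> card (A' \<times> A') * k"
    using finA' by (intro mult_right_mono card_mono) auto
  finally have cZA: "card ZA \<le> N * N * k" using A'(2) by (simp add: card_cartesian_product)
  obtain PA where PA: "finite PA" "card PA * (d * d) \<le> card ZA"
    "\<And>l u. PA \<inter> {l<..<u} = {} \<Longrightarrow> card {i\<in>ZA. snd i \<in> {l<..<u}} \<le> d * d"
    using cut_points_exist[OF finZA, of "d * d" snd] kw by (auto simp: d_def)
  have "card PA * (d * d) \<le> (4665600 * k) * (d * d)"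
  proof -
    have "N * N * k = (4665600 * k) * (d * d)" by (simp add: N_def d_def)
    then show ?thesis using PA(2) cZA by linarith
  qed
  then have cPA: "card PA \<le> 4665600 * k" using kw by (simp add: d_def)
  have finZB: "finite (B' \<times> (UNIV :: (bool \<times> bool) set))" using finB' by simp
  obtain PB where PB: "finite PB" "card PB * h \<le> card (B' \<times> (UNIV :: (bool \<times> bool) set))"
    "\<And>l u. PB \<inter> {l<..<u} = {} \<Longrightarrow>
      card {i\<in>B' \<times> UNIV. hull_ends g B' h i \<in> {l<..<u}} \<le> h"
    using cut_points_exist[OF finZB, of h "hull_ends g B' h"] kw by (auto simp: h_def)
  have "card (B' \<times> (UNIV :: (bool \<times> bool) set)) = 4 * N"
    using B'(2) by (simp add: card_cartesian_product flip: UNIV_Times_UNIV)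
  then have "card PB * h \<le> (4 * 4665600 * k) * h"
    using PB(2) by (simp add: N_def h_def algebra_simps)
  then have cPB: "card PB \<le> 4 * 4665600 * k" using kw by (simp add: h_def)
  \<comment> \<open>The intersection discards junk ends of empty hulls; a point outside [0,1] lies
    in no strip anyway.\<close>
  define P where "P = {0, 1} \<union> (PA \<union> PB) \<inter> {0..1}"
  have "card ((PA \<union> PB) \<inter> {0..1}) \<le> card (PA \<union> PB)" using PA(1) PB(1) by (intro card_mono) auto
  also have "\<dots> \<le> card PA + card PB" by (rule card_Un_le)
  finally have cP: "card P \<le> 2 + 5 * 4665600 * k"
    using card_Un_le[of "{0::real, 1}" "(PA \<union> PB) \<inter> {0..1}"] cPA cPB unfolding P_def by simp
  have "finite P" "P \<subseteq> {0..1}" "0 \<in> P" "1 \<in> P" using PA(1) PB(1) by (auto simp: P_def)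
  then obtain t m where t: "card P = Suc m" "m > 0" "\<And>i j. i < j \<Longrightarrow> j \<le> m \<Longrightarrow> t i < t j"
    "\<And>i. i \<le> m \<Longrightarrow> t i \<in> {0..1}"
    "\<And>s. s < m \<Longrightarrow> P \<inter> {t s<..<t (Suc s)} = {}"
    "\<And>x. x \<in> {0..1} \<Longrightarrow> \<exists>s<m. x \<in> {t s..t (Suc s)}"
    by (rule consecutive_gaps) blast
  \<comment> \<open>The summand 2 for the points 0 and 1 is absorbed by raising the factor 5 to
    6.\<close>
  have m_le: "m \<le> 6 * 4665600 * k" using cP t(1) kw(1) by linarith
  define I where "I s = {t s..t (Suc s)}" for s
  have I01: "I s \<subseteq> {0..1}" if "s < m" for s
    using t(4)[of s] t(4)[of "Suc s"] that by (auto simp: I_def)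
  have disj: "PA \<inter> {t s<..<t (Suc s)} = {}" "PB \<inter> {t s<..<t (Suc s)} = {}" if "s < m" for s
    using t(5)[OF that] I01[OF that] by (auto simp: P_def I_def)
  have lt: "t s < t (Suc s)" if "s < m" for s using t(3)[of s "Suc s"] that by simp
  \<comment> \<open>Negating the functions turns the bottom curves of the separator lemma into top
    curves.\<close>
  have "\<exists>K E. K \<subseteq> A' \<and> E \<subseteq> A' \<and> d \<le> card K \<and> card E \<le> 5 * d \<and>
      (\<forall>a\<in>A' - E. \<forall>b\<in>K. \<forall>x\<in>I s. - f b x \<le> - f a x)" if s: "s < m" for s
    unfolding I_def
  proof (rule low_separator_if_few_crossings[OF finA' lt[OF s] _ refl])
    let ?Z = "{(a, b, x). a \<in> A' \<and> b \<in> A' \<and> a \<noteq> b \<and> x \<in> {t s<..<t (Suc s)} \<and> - f a x = - f b x}"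
    let ?Y = "{i\<in>ZA. snd i \<in> {t s<..<t (Suc s)}}"
    have sub: "?Z \<subseteq> (\<lambda>((a, b), x). (a, b, x)) ` ?Y"
    proof
      fix i assume "i \<in> ?Z"
      then obtain a b x where "i = (a, b, x)" "((a, b), x) \<in> ?Y"
        using I01[OF s] by (force simp: ZA_def I_def)
      then show "i \<in> (\<lambda>((a, b), x). (a, b, x)) ` ?Y" by force
    qed
    have finY: "finite ?Y" using finZA by simp
    show "finite ?Z" by (rule finite_subset[OF sub]) (use finY in simp)
    have "card ?Z \<le> card ((\<lambda>((a, b), x). (a, b, x)) ` ?Y)"
      using finY by (intro card_mono sub) simp
    also have "\<dots> \<le> card ?Y" by (rule card_image_le[OF finY])
    also have "\<dots> \<le> d * d" by (rule PA(3)[OF disj(1)[OF s]])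
    finally show "card ?Z \<le> d * d" .
    show "continuous_on {t s..t (Suc s)} (\<lambda>x. - f a x)" if "a \<in> A'" for a
      using that A'(1) I01[OF s] unfolding I_def
      by (intro continuous_on_minus continuous_on_subset[OF contf]) auto
  qed (use kw A'(2) in \<open>auto simp: d_def N_def\<close>)
  then obtain KA EA where KA: "\<And>s. s < m \<Longrightarrow> KA s \<subseteq> A' \<and> EA s \<subseteq> A' \<and> d \<le> card (KA s) \<and>
      card (EA s) \<le> 5 * d \<and> (\<forall>a\<in>A' - EA s. \<forall>b\<in>KA s. \<forall>x\<in>I s. - f b x \<le> - f a x)"
    by metis
  define EB where "EB s = {b\<in>B'. low_hull g B' (4 * h) b \<inter> {t s<..<t (Suc s)} \<noteq> {}}" for s
  have stripB: "card (EB s) \<le> 9 * h \<and> (\<exists>K\<subseteq>B'. h \<le> card K \<and>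
      (\<forall>b\<in>B' - EB s. \<forall>c\<in>K. \<forall>x\<in>I s. g c x \<le> g b x))" if s: "s < m" for s
    unfolding I_def
  proof (rule low_separator_if_few_hull_ends[OF finB' lt[OF s] _ _ _ _ PB(3)[OF disj(2)[OF s]] _ EB_def])
    show "{t s..t (Suc s)} \<subseteq> {0..1}" using I01[OF s] by (simp add: I_def)
    show "2 * h \<le> card B'" using B'(2) kw(1) by (simp add: h_def N_def)
    show "finite {x\<in>{0..1}. g b x = g c x}" "is_interval {x\<in>{0..1}. g b x < g c x}"
      if "b \<in> B'" "c \<in> B'" "b \<noteq> c" for b c
      using crossB[of b c] conv[of b c] that B'(1) by auto
  qed (use B'(1) contg in auto)
  then obtain KB where KB: "\<And>s. s < m \<Longrightarrow> KB s \<subseteq> B' \<and> h \<le> card (KB s) \<and>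
      (\<forall>b\<in>B' - EB s. \<forall>c\<in>KB s. \<forall>x\<in>I s. g c x \<le> g b x)"
    by metis
  have mono: "t i \<le> t j" if "i \<le> j" "j \<le> m" for i j
    using t(3)[of i j] that by (cases "i = j") auto
  have "\<exists>A0\<subseteq>A'. \<exists>B0\<subseteq>B'. w \<le> card A0 \<and> w \<le> card B0 \<and>
    ((\<forall>a\<in>A0. \<forall>b\<in>B0. \<exists>x\<in>{0..1}. f a x = g b x) \<or>
     (\<forall>a\<in>A0. \<forall>b\<in>B0. \<forall>x\<in>{0..1}. f a x \<noteq> g b x))"
  proof (rule strips_to_biclique[OF finA' finB' A'(2) B'(2) t(2)])
    \<comment> \<open>The factors in \<open>h\<close> and \<open>d\<close> are chosen for this
      condition and the next: \<open>h = 24 * w\<close> because 24 = 4 * 6, and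
      \<open>N = 2160 * d\<close> because 2160 = 4 * 108 * 5.\<close>
    have "4 * (m * w) \<le> 4 * (6 * 4665600 * k * w)"
      by (intro mult_left_mono mult_right_mono m_le) auto
    then show "4 * (m * w) \<le> N" by (simp add: N_def)
    show "4 * (108 * (5 * d)) \<le> N" by (simp add: d_def N_def)
    show "0 < N" using kw by (simp add: N_def)
    show "\<exists>s<m. x \<in> I s" if "x \<in> {0..1}" for x using t(6)[OF that] by (simp add: I_def)
    show "KA s \<subseteq> A' \<and> w \<le> card (KA s)" if "s < m" for s
    proof -
      have "w \<le> d" using kw(1) by (simp add: d_def)
      then show ?thesis using KA[OF that] by linarith
    qed
    show "KB s \<subseteq> B' \<and> w \<le> card (KB s)" if "s < m" for s
      using KB[OF that] by (simp add: h_def)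
    \<comment> \<open>This is the source of the average 54: at most \<open>9 * h\<close> exceptional
      curves per strip, and 6 times N/h bounds the number of strips.\<close>
    have "(\<Sum>s<m. card (EB s)) \<le> (\<Sum>s<m. 9 * h)" using stripB by (intro sum_mono) auto
    also have "\<dots> = m * (9 * h)" by simp
    also have "\<dots> \<le> 6 * 4665600 * k * (9 * h)" by (rule mult_right_mono[OF m_le]) simp
    also have "\<dots> = 54 * N" by (simp add: N_def h_def)
    finally show "(\<Sum>s<m. card (EB s)) \<le> 54 * N" .
    show "b \<in> EB s'" if le: "s \<le> s'" "s' \<le> s''" "s'' < m" and b: "b \<in> EB s" "b \<in> EB s''"
      for s s' s'' b
    proof (cases "s = s' \<or> s' = s''")
      case False
      then have s: "Suc s \<le> s'" "Suc s' \<le> s''" using le by auto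
      obtain x z where x: "x \<in> low_hull g B' (4 * h) b" "x < t (Suc s)"
        and z: "z \<in> low_hull g B' (4 * h) b" "t s'' < z" using b by (auto simp: EB_def)
      obtain y where y: "t s' < y" "y < t (Suc s')" using dense[OF lt, of s'] le by auto
      have "x \<le> y" "y \<le> z" using x(2) z(2) y mono[OF s(1)] mono[OF s(2)] le by auto
      then have "y \<in> low_hull g B' (4 * h) b" using x(1) z(1) by (rule low_hull_between[rotated 2])
      then show ?thesis using y b(1) by (auto simp: EB_def)
    qed (use b in auto)
    show "EA s \<subseteq> A' \<and> card (EA s) \<le> 5 * d" if "s < m" for s
      using KA[OF that] by blast
    show "f a x \<le> f a' x" if "s < m" "a \<in> A' - EA s" "a' \<in> KA s" "x \<in> I s" for s a a' x
    proof -
      have "- f a' x \<le> - f a x" using KA[OF that(1)] that(2-4) by blast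
      then show ?thesis by simp
    qed
    show "g b' x \<le> g b x" if "s < m" "b \<in> B' - EB s" "b' \<in> KB s" "x \<in> I s" for s b b' x
      using KB[OF that(1)] that(2-4) by blast
    show "EB s \<subseteq> B'" for s by (auto simp: EB_def)
    show "f a 0 \<le> g b 0" if "a \<in> A'" "b \<in> B'" for a b using start that A'(1) B'(1) by blast
    show "continuous_on {0..1} (f a)" if "a \<in> A'" for a using contf that A'(1) by blast
    show "continuous_on {0..1} (g b)" if "b \<in> B'" for b using contg that B'(1) by blast
  qed (rule I01)
  then show ?thesis using A'(1) B'(1) by (rule ex_subsets_mono)
qed

text \<open>Both families are split into halves by their values at 0. If the lower half of
  \<open>A\<close> does not start below the upper half of \<open>B\<close>, some \<open>b\<close> in
  the upper half starts below some \<open>a\<close> in the lower half; then all of the lower half of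
  \<open>B\<close> starts below all of the upper half of \<open>A\<close>, and reflection restores
  the required order.\<close>

lemma biclique_of_functions:
  fixes f :: "'a \<Rightarrow> real \<Rightarrow> real" and g :: "'b \<Rightarrow> real \<Rightarrow> real"
  assumes kw: "k > 0" "w > 0"
    and fin: "finite A" "finite B" and card: "card A = n" "card B = n" "111974400 * k * w \<le> n div 2"
    and contf: "\<And>a. a \<in> A \<Longrightarrow> continuous_on {0..1} (f a)"
    and contg: "\<And>b. b \<in> B \<Longrightarrow> continuous_on {0..1} (g b)"
    and crossA: "\<And>a b. a \<in> A \<Longrightarrow> b \<in> A \<Longrightarrow> a \<noteq> b \<Longrightarrow>
        finite {x\<in>{0..1}. f a x = f b x} \<and> card {x\<in>{0..1}. f a x = f b x} \<le> k"
    and crossB: "\<And>b c. b \<in> B \<Longrightarrow> c \<in> B \<Longrightarrow> b \<noteq> c \<Longrightarrow> finite {x\<in>{0..1}. g b x = g c x}"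
    and conv: "\<And>b c. b \<in> B \<Longrightarrow> c \<in> B \<Longrightarrow> b \<noteq> c \<Longrightarrow> is_interval {x\<in>{0..1}. g b x < g c x}"
  shows "\<exists>A0\<subseteq>A. \<exists>B0\<subseteq>B. w \<le> card A0 \<and> w \<le> card B0 \<and>
    ((\<forall>a\<in>A0. \<forall>b\<in>B0. \<exists>x\<in>{0..1}. f a x = g b x) \<or>
     (\<forall>a\<in>A0. \<forall>b\<in>B0. \<forall>x\<in>{0..1}. f a x \<noteq> g b x))"
proof -
  have "n div 2 \<le> card A" "n div 2 \<le> card B" using card by auto
  then obtain A1 B1 where A1: "A1 \<subseteq> A" "card A1 = n div 2" "\<forall>y\<in>A1. \<forall>z\<in>A - A1. f y 0 \<le> f z 0"
    and B1: "B1 \<subseteq> B" "card B1 = n div 2" "\<forall>y\<in>B1. \<forall>z\<in>B - B1. g y 0 \<le> g z 0"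
    using lower_part_exists[OF fin(1), of _ "\<lambda>a. f a 0"] lower_part_exists[OF fin(2), of _ "\<lambda>b. g b 0"]
    by metis
  have finAB1: "finite A1" "finite B1" 
    using finite_subset[OF A1(1) fin(1)] finite_subset[OF B1(1) fin(2)] by simp_all
  have compl: "n div 2 \<le> card (A - A1)" "n div 2 \<le> card (B - B1)"
    using A1 B1 finAB1 card by (auto simp: card_Diff_subset)
  show ?thesis
  proof (cases "\<forall>a\<in>A1. \<forall>b\<in>B - B1. f a 0 \<le> g b 0")
    case True
    have "\<exists>A0\<subseteq>A1. \<exists>B0\<subseteq>B - B1. w \<le> card A0 \<and> w \<le> card B0 \<and>
      ((\<forall>a\<in>A0. \<forall>b\<in>B0. \<exists>x\<in>{0..1}. f a x = g b x) \<or>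
       (\<forall>a\<in>A0. \<forall>b\<in>B0. \<forall>x\<in>{0..1}. f a x \<noteq> g b x))"
    proof (rule biclique_if_ordered_at_0[OF kw finAB1(1)])
      show "finite {x\<in>{0..1}. f a x = f b x} \<and> card {x\<in>{0..1}. f a x = f b x} \<le> k"
        if "a \<in> A1" "b \<in> A1" "a \<noteq> b" for a b
        using crossA[of a b] that A1(1) by auto
    qed (use True fin A1 compl card contf contg crossB conv in auto)
    then show ?thesis using A1(1) Diff_subset by (rule ex_subsets_mono)
  next
    case False
    then obtain a b where ab: "a \<in> A1" "b \<in> B - B1" "g b 0 < f a 0" by (auto simp: not_le)
    have start: "g b' 0 \<le> f a' 0" if "a' \<in> A - A1" "b' \<in> B1" for a' b'
    proof -
      have "g b' 0 \<le> g b 0" "f a 0 \<le> f a' 0" using that ab A1(3) B1(3) by auto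
      then show ?thesis using ab(3) by linarith
    qed
    have "\<exists>A0\<subseteq>A - A1. \<exists>B0\<subseteq>B1. w \<le> card A0 \<and> w \<le> card B0 \<and>
      ((\<forall>a\<in>A0. \<forall>b\<in>B0. \<exists>x\<in>{0..1}. - f a x = - g b x) \<or>
       (\<forall>a\<in>A0. \<forall>b\<in>B0. \<forall>x\<in>{0..1}. - f a x \<noteq> - g b x))"
    proof (rule biclique_if_ordered_at_0[OF kw _ finAB1(2)])
      show "is_interval {x\<in>{0..1}. - g b x < - g c x}" if "b \<in> B1" "c \<in> B1" "b \<noteq> c" for b c
        using conv[of c b] that B1(1) by auto
      show "continuous_on {0..1} (\<lambda>x. - f a x)" if "a \<in> A - A1" for a
        using that by (intro continuous_on_minus contf) auto
      show "continuous_on {0..1} (\<lambda>x. - g b x)" if "b \<in> B1" for b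
        using that B1(1) by (intro continuous_on_minus contg) auto
      show "finite {x\<in>{0..1}. - g b x = - g c x}" if "b \<in> B1" "c \<in> B1" "b \<noteq> c" for b c
        using crossB[of b c] that B1(1) by auto
    qed (use fin B1 compl card crossA start in auto)
    then show ?thesis unfolding neg_equal_iff_equal using Diff_subset B1(1) by (rule ex_subsets_mono)
  qed
qed

section \<open>From curves as point sets to functions\<close>

lemma mem_graph01: "(x, y) \<in> graph01 f \<longleftrightarrow> x \<in> {0..1} \<and> y = f x"
  by (auto simp: graph01_def)

lemma graph01_Int: "graph01 f \<inter> graph01 g = (\<lambda>x. (x, f x)) ` {x\<in>{0..1}. f x = g x}"
  by (auto simp: graph01_def)

lemma card_graph01_Int: "card (graph01 f \<inter> graph01 g) = card {x\<in>{0..1}. f x = g x}"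
  unfolding graph01_Int by (rule card_image) (auto simp: inj_on_def)

lemma finite_graph01_Int: "finite (graph01 f \<inter> graph01 g) \<longleftrightarrow> finite {x\<in>{0..1}. f x = g x}"
  unfolding graph01_Int by (rule finite_image_iff) (auto simp: inj_on_def)

text \<open>Which way the curves cross is unknown, but either way \<open>g\<close> runs below
  \<open>f\<close> on one side, and the next lemma uses just that.\<close>

lemma crossing_sides:
  assumes "properly_crosses_at (graph01 f) (graph01 g) (y, f y)" "y \<in> {0..1}"
  obtains \<epsilon> where "\<epsilon> > 0" "0 \<le> y - \<epsilon>" "y + \<epsilon> \<le> 1"
    "(\<forall>x\<in>{y - \<epsilon><..<y}. g x < f x) \<or> (\<forall>x\<in>{y<..<y + \<epsilon>}. g x < f x)"
proof -
  obtain \<epsilon> where e: "\<epsilon> > 0" "0 \<le> y - \<epsilon>" "y + \<epsilon> \<le> 1"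
    and b: "below_on {y<..<y + \<epsilon>} (graph01 g) (graph01 f) \<or> below_on {y - \<epsilon><..<y} (graph01 g) (graph01 f)"
    using assms(1) unfolding properly_crosses_at_def fst_conv by blast
  have less: "g x < f x" if "below_on S (graph01 g) (graph01 f)" "x \<in> S" "x \<in> {0..1}" for S x
    using that unfolding below_on_def mem_graph01 by simp
  have "(\<forall>x\<in>{y - \<epsilon><..<y}. g x < f x) \<or> (\<forall>x\<in>{y<..<y + \<epsilon>}. g x < f x)"
    using b
  proof
    assume b1: "below_on {y<..<y + \<epsilon>} (graph01 g) (graph01 f)"
    have "\<forall>x\<in>{y<..<y + \<epsilon>}. g x < f x" using e assms(2) by (intro ballI less[OF b1]) simp_all
    then show ?thesis ..
  next
    assume b1: "below_on {y - \<epsilon><..<y} (graph01 g) (graph01 f)"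
    have "\<forall>x\<in>{y - \<epsilon><..<y}. g x < f x" using e assms(2) by (intro ballI less[OF b1]) simp_all
    then show ?thesis ..
  qed
  then show ?thesis using e that by blast
qed

text \<open>Suppose \<open>f < g\<close> at two points but not at some \<open>y\<close> between
  them. The intermediate value theorem gives a crossing on each side of \<open>y\<close>, possibly
  at \<open>y\<close>; as there is only one, it is \<open>y\<close> itself. A mere touching is
  excluded by properness: near \<open>y\<close>, on one side, \<open>g\<close> runs below
  \<open>f\<close>, which forces a second crossing on that side.\<close>

lemma is_interval_less_if_crossing_once:
  assumes cont: "continuous_on {0..1} f" "continuous_on {0..1} g"
    and once: "finite {x\<in>{0..1}. f x = g x}" "card {x\<in>{0..1}. f x = g x} \<le> 1"
    and proper: "\<And>y. y \<in> {0..1} \<Longrightarrow> f y = g y \<Longrightarrow> properly_crosses_at (graph01 f) (graph01 g) (y, f y)"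
  shows "is_interval {x\<in>{0..1}. f x < g x}"
proof -
  have "f y < g y" if x: "x \<in> {0..1}" "f x < g x" and z: "z \<in> {0..1}" "f z < g z" and y: "x \<le> y" "y \<le> z" for x y z
  proof (rule ccontr)
    assume nl: "\<not> f y < g y"
    have y01: "y \<in> {0..1}" using x z y by auto
    have uniq: "p = q" if "p \<in> {0..1}" "q \<in> {0..1}" "f p = g p" "f q = g q" for p q
      
    proof -
      have "\<forall>p\<in>{x\<in>{0..1}. f x = g x}. \<forall>q\<in>{x\<in>{0..1}. f x = g x}. p = q"
        using once(2) unfolding One_nat_def card_le_Suc0_iff_eq[OF once(1)] .
      then show ?thesis using that by blast
    qed
    have root: "\<exists>p\<in>{0..1}. min u v \<le> p \<and> p \<le> max u v \<and> f p = g p"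
      if "u \<in> {0..1}" "v \<in> {0..1}" "f u < g u" "g v \<le> f v" for u v
      by (rule crossing_between[OF cont is_interval_cc that(1,2) order_less_imp_le[OF that(3)] that(4)])
    obtain p where p: "p \<in> {0..1}" "p \<le> y" "f p = g p"
      using root[OF x(1) y01 x(2)] nl y by (auto simp: max_absorb2)
    obtain q where q: "q \<in> {0..1}" "y \<le> q" "f q = g q"
      using root[OF z(1) y01 z(2)] nl y by (auto simp: min_absorb2)
    have "p = q" using uniq p q by blast
    then have "p = y" using p(2) q(2) by simp
    then have eq: "f y = g y" using p(3) by simp
    have "x \<noteq> y" "z \<noteq> y" using eq x(2) z(2) by auto
    then have xyz: "x < y" "y < z" using y by simp_all
    obtain \<epsilon> where e: "\<epsilon> > 0" "0 \<le> y - \<epsilon>" "y + \<epsilon> \<le> 1"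
      "(\<forall>x\<in>{y - \<epsilon><..<y}. g x < f x) \<or> (\<forall>x\<in>{y<..<y + \<epsilon>}. g x < f x)"
      by (rule crossing_sides[OF proper[OF y01 eq] y01])
    from e(4) show False
    proof
      assume l: "\<forall>x\<in>{y - \<epsilon><..<y}. g x < f x"
      obtain v where v: "x < v" "y - \<epsilon> < v" "v < y"
        using dense[of "max x (y - \<epsilon>)" y] xyz e(1) by auto
      have v01: "v \<in> {0..1}" using v y01 x(1) by simp
      have gv: "g v \<le> f v" using l v by (simp add: order_less_imp_le)
      obtain r where r: "r \<in> {0..1}" "r \<le> max x v" "f r = g r"
        using root[OF x(1) v01 x(2) gv] by blast
      then have "r = y" using uniq y01 eq by blast
      then show False using r(2) v by simp
    next
      assume l: "\<forall>x\<in>{y<..<y + \<epsilon>}. g x < f x"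
      obtain v where v: "y < v" "v < z" "v < y + \<epsilon>"
        using dense[of y "min z (y + \<epsilon>)"] xyz e(1) by auto
      have v01: "v \<in> {0..1}" using v y01 z(1) by simp
      have gv: "g v \<le> f v" using l v by (simp add: order_less_imp_le)
      obtain r where r: "r \<in> {0..1}" "min z v \<le> r" "f r = g r"
        using root[OF z(1) v01 z(2) gv] by blast
      then have "r = y" using uniq y01 eq by blast
      then show False using r(2) v by simp
    qed
  qed
  moreover have "y \<in> {0..1}" if "x \<in> {0..1}" "z \<in> {0..1}" "x \<le> y" "y \<le> z" for x y z :: real
    using that by auto
  ultimately show ?thesis unfolding is_interval_1 by blast
qed

lemma biclique_of_curves:
  assumes A: "curve_collection \<A>" "k_intersecting k \<A>" "card \<A> = n"
    and B: "curve_collection \<B>" "k_intersecting 1 \<B>" "card \<B> = n"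
    and kw: "k > 0" "w > 0" "111974400 * k * w \<le> n div 2"
  shows "\<exists>\<A>\<^sub>0\<subseteq>\<A>. \<exists>\<B>\<^sub>0\<subseteq>\<B>. card \<A>\<^sub>0 = w \<and> card \<B>\<^sub>0 = w \<and>
    ((\<forall>\<alpha>\<in>\<A>\<^sub>0. \<forall>\<beta>\<in>\<B>\<^sub>0. \<alpha> \<inter> \<beta> \<noteq> {}) \<or> (\<forall>\<alpha>\<in>\<A>\<^sub>0. \<forall>\<beta>\<in>\<B>\<^sub>0. \<alpha> \<inter> \<beta> = {}))"
proof -
  \<comment> \<open>The curves themselves index the chosen functions, so sizes of subfamilies carry
    over unchanged.\<close>
  define F where "F \<gamma> = (SOME f. continuous_on {0..1} f \<and> \<gamma> = graph01 f)" for \<gamma>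
  have F: "continuous_on {0..1} (F \<gamma>)" "\<gamma> = graph01 (F \<gamma>)" if "\<gamma> \<in> \<A> \<union> \<B>" for \<gamma>
  proof -
    have "\<exists>f. continuous_on {0..1} f \<and> \<gamma> = graph01 f"
      using that A(1) B(1) by (auto simp: curve_collection_def zero_one_curve_def)
    then show "continuous_on {0..1} (F \<gamma>)" "\<gamma> = graph01 (F \<gamma>)"
      unfolding F_def by (rule someI2_ex, simp)+
  qed
  have fin: "finite \<A>" "finite \<B>" using A B by (auto simp: curve_collection_def)
  have cross: "finite {x\<in>{0..1}. F \<gamma> x = F \<delta> x} \<and> card {x\<in>{0..1}. F \<gamma> x = F \<delta> x} \<le> j"
    if "k_intersecting j \<C>" "\<C> \<subseteq> \<A> \<union> \<B>" "\<gamma> \<in> \<C>" "\<delta> \<in> \<C>" "\<gamma> \<noteq> \<delta>" for \<C> j \<gamma> \<delta>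
  proof -
    have "\<gamma> = graph01 (F \<gamma>)" "\<delta> = graph01 (F \<delta>)" using that(2-4) F(2) by blast+
    moreover have "finite (\<gamma> \<inter> \<delta>) \<and> card (\<gamma> \<inter> \<delta>) \<le> j"
      using that unfolding k_intersecting_def pairwise_def by blast
    ultimately show ?thesis
      using card_graph01_Int[of "F \<gamma>" "F \<delta>"] finite_graph01_Int[of "F \<gamma>" "F \<delta>"] by simp
  qed
  have conv: "is_interval {x\<in>{0..1}. F \<beta> x < F \<gamma> x}" if bc: "\<beta> \<in> \<B>" "\<gamma> \<in> \<B>" "\<beta> \<noteq> \<gamma>" for \<beta> \<gamma>
  proof (rule is_interval_less_if_crossing_once)
    have gr: "graph01 (F \<beta>) = \<beta>" "graph01 (F \<gamma>) = \<gamma>" using F(2) bc by simp_all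
    show "properly_crosses_at (graph01 (F \<beta>)) (graph01 (F \<gamma>)) (y, F \<beta> y)"
      if "y \<in> {0..1}" "F \<beta> y = F \<gamma> y" for y
    proof -
      have "(y, F \<beta> y) \<in> graph01 (F \<beta>) \<inter> graph01 (F \<gamma>)" using that by (simp add: mem_graph01)
      then show ?thesis using B(1) bc unfolding gr
        unfolding curve_collection_def only_proper_crossings_def pairwise_def by blast
    qed
  qed (use F(1) bc cross[OF B(2) Un_upper2 bc] in blast)+
  have "\<exists>A0\<subseteq>\<A>. \<exists>B0\<subseteq>\<B>. w \<le> card A0 \<and> w \<le> card B0 \<and>
    ((\<forall>\<alpha>\<in>A0. \<forall>\<beta>\<in>B0. \<exists>x\<in>{0..1}. F \<alpha> x = F \<beta> x) \<or>
     (\<forall>\<alpha>\<in>A0. \<forall>\<beta>\<in>B0. \<forall>x\<in>{0..1}. F \<alpha> x \<noteq> F \<beta> x))"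
  proof (rule biclique_of_functions[OF kw(1,2) fin A(3) B(3) kw(3)])
    show "finite {x\<in>{0..1}. F \<alpha> x = F \<beta> x} \<and> card {x\<in>{0..1}. F \<alpha> x = F \<beta> x} \<le> k"
      if "\<alpha> \<in> \<A>" "\<beta> \<in> \<A>" "\<alpha> \<noteq> \<beta>" for \<alpha> \<beta>
      using cross[OF A(2) Un_upper1 that] .
    show "finite {x\<in>{0..1}. F \<alpha> x = F \<beta> x}" if "\<alpha> \<in> \<B>" "\<beta> \<in> \<B>" "\<alpha> \<noteq> \<beta>" for \<alpha> \<beta>
      using cross[OF B(2) Un_upper2 that] ..
  qed (use F(1) conv in blast)+
  then obtain A0 B0 where *: "A0 \<subseteq> \<A>" "B0 \<subseteq> \<B>" "w \<le> card A0" "w \<le> card B0"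
    "(\<forall>\<alpha>\<in>A0. \<forall>\<beta>\<in>B0. \<exists>x\<in>{0..1}. F \<alpha> x = F \<beta> x) \<or> (\<forall>\<alpha>\<in>A0. \<forall>\<beta>\<in>B0. \<forall>x\<in>{0..1}. F \<alpha> x \<noteq> F \<beta> x)"
    by blast
  \<comment> \<open>Both alternatives pass to subfamilies, so trimming to exactly \<open>w\<close>
    curves makes the sizes equal.\<close>
  obtain A1 B1 where **: "A1 \<subseteq> A0" "card A1 = w" "B1 \<subseteq> B0" "card B1 = w"
    using obtain_subset_with_card_n[OF *(3)] obtain_subset_with_card_n[OF *(4)] by metis
  have disj: "\<alpha> \<inter> \<beta> = {} \<longleftrightarrow> (\<forall>x\<in>{0..1}. F \<alpha> x \<noteq> F \<beta> x)" if "\<alpha> \<in> A1" "\<beta> \<in> B1" for \<alpha> \<beta>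
  proof -
    have "\<alpha> = graph01 (F \<alpha>)" "\<beta> = graph01 (F \<beta>)" using that *(1,2) **(1,3) F(2) by blast+
    then have "\<alpha> \<inter> \<beta> = (\<lambda>x. (x, F \<alpha> x)) ` {x\<in>{0..1}. F \<alpha> x = F \<beta> x}"
      using graph01_Int[of "F \<alpha>" "F \<beta>"] by simp
    then show ?thesis by (simp only: image_is_empty) blast
  qed
  have "(\<forall>\<alpha>\<in>A1. \<forall>\<beta>\<in>B1. \<alpha> \<inter> \<beta> \<noteq> {}) \<or> (\<forall>\<alpha>\<in>A1. \<forall>\<beta>\<in>B1. \<alpha> \<inter> \<beta> = {})"
    using *(5)
  proof (elim disjE)
    assume "\<forall>\<alpha>\<in>A0. \<forall>\<beta>\<in>B0. \<exists>x\<in>{0..1}. F \<alpha> x = F \<beta> x"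
    then show ?thesis using disj **(1,3) by (intro disjI1) blast
  next
    assume "\<forall>\<alpha>\<in>A0. \<forall>\<beta>\<in>B0. \<forall>x\<in>{0..1}. F \<alpha> x \<noteq> F \<beta> x"
    then show ?thesis using disj **(1,3) by (intro disjI2) blast
  qed
  moreover have "A1 \<subseteq> \<A>" "B1 \<subseteq> \<B>" using *(1,2) **(1,3) by simp_all
  ultimately show ?thesis using **(2,4) by (intro exI[of _ A1] exI[of _ B1] conjI)
qed

section \<open>The absolute constant and the case of small n\<close>

theorem theorem9p7:
  "\<exists>c::real. c > 0 \<and>
     (\<forall>k::nat. k \<ge> 1 \<longrightarrow>
       (\<forall>(n::nat) (\<A> :: (real \<times> real) set set) (\<B> :: (real \<times> real) set set).
          curve_collection \<A> \<and> card \<A> = n \<and>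
          curve_collection \<B> \<and> card \<B> = n \<and>
          k_intersecting k \<A> \<and> k_intersecting 1 \<B> \<longrightarrow>
          (\<exists>\<A>\<^sub>0 \<B>\<^sub>0. \<A>\<^sub>0 \<subseteq> \<A> \<and> \<B>\<^sub>0 \<subseteq> \<B> \<and>
             card \<A>\<^sub>0 = card \<B>\<^sub>0 \<and> real (card \<A>\<^sub>0) \<ge> c * real n / real k \<and>
             ((\<forall>\<alpha>\<in>\<A>\<^sub>0. \<forall>\<beta>\<in>\<B>\<^sub>0. \<alpha> \<inter> \<beta> \<noteq> {}) \<or>
              (\<forall>\<alpha>\<in>\<A>\<^sub>0. \<forall>\<beta>\<in>\<B>\<^sub>0. \<alpha> \<inter> \<beta> = {})))))"
proof (intro exI[of _ "1 / 447897600"] conjI allI impI)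
  fix k n :: nat and \<A> \<B> :: "(real \<times> real) set set"
  assume k: "1 \<le> k"
  assume "curve_collection \<A> \<and> card \<A> = n \<and> curve_collection \<B> \<and> card \<B> = n \<and>
    k_intersecting k \<A> \<and> k_intersecting 1 \<B>"
  then have A: "curve_collection \<A>" "k_intersecting k \<A>" "card \<A> = n"
    and B: "curve_collection \<B>" "k_intersecting 1 \<B>" "card \<B> = n" by auto
  \<comment> \<open>The constant is 1 / (4 * 111974400): one factor 2 pays for halving the families,
    the other for rounding, since (w + 1) / 2 is at most w once w is positive.\<close>
  define M where "M = 111974400 * k"
  define w where "w = (n div 2) div M"
  have "M > 0" using k by (simp add: M_def)
  then have "n div 2 < M * (w + 1)"
    unfolding w_def by (metis Suc_eq_plus1 dividend_less_times_div mult_Suc_right add.commute)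
  then have "n \<le> 2 * (M * (w + 1))" by linarith
  then have bound: "1 / 447897600 * real n / real k \<le> (real w + 1) / 2"
  proof -
    have "real n \<le> real (2 * (M * (w + 1)))" using \<open>n \<le> 2 * (M * (w + 1))\<close> by (rule of_nat_mono)
    then show ?thesis using k by (simp add: M_def field_simps)
  qed
  show "\<exists>\<A>\<^sub>0 \<B>\<^sub>0. \<A>\<^sub>0 \<subseteq> \<A> \<and> \<B>\<^sub>0 \<subseteq> \<B> \<and>
      card \<A>\<^sub>0 = card \<B>\<^sub>0 \<and> real (card \<A>\<^sub>0) \<ge> 1 / 447897600 * real n / real k \<and>
      ((\<forall>\<alpha>\<in>\<A>\<^sub>0. \<forall>\<beta>\<in>\<B>\<^sub>0. \<alpha> \<inter> \<beta> \<noteq> {}) \<or> (\<forall>\<alpha>\<in>\<A>\<^sub>0. \<forall>\<beta>\<in>\<B>\<^sub>0. \<alpha> \<inter> \<beta> = {}))"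
  proof (cases "w = 0")
    case False
    have "M * w \<le> n div 2" unfolding w_def by simp
    then obtain A0 B0 where "A0 \<subseteq> \<A>" "B0 \<subseteq> \<B>" "card A0 = w" "card B0 = w"
      "(\<forall>\<alpha>\<in>A0. \<forall>\<beta>\<in>B0. \<alpha> \<inter> \<beta> \<noteq> {}) \<or> (\<forall>\<alpha>\<in>A0. \<forall>\<beta>\<in>B0. \<alpha> \<inter> \<beta> = {})"
      using biclique_of_curves[OF A B, of w] k False by (auto simp: M_def)
    moreover have "(real w + 1) / 2 \<le> real w" using False by simp
    ultimately show ?thesis using bound by (intro exI[of _ A0] exI[of _ B0]) auto
  next
    case True
    \<comment> \<open>For \<open>w = 0\<close> the required size is at most 1/2, and a single pair
      of curves either meets or is disjoint.\<close>
    show ?thesis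
    proof (cases "n = 0")
      case False
      then obtain \<alpha> \<beta> where "\<alpha> \<in> \<A>" "\<beta> \<in> \<B>" using A(3) B(3) by (metis card.empty ex_in_conv)
      then show ?thesis using bound True by (intro exI[of _ "{\<alpha>}"] exI[of _ "{\<beta>}"]) auto
    qed (intro exI[of _ "{}"], simp)
  qed
qed simp

end
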